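(* Let $W=w_1\oplus w_2\oplus\cdots\oplus w_N$ be a direct sum of classical scalar weights of the same type (shifted Hermite, Laguerre, or Jacobi). Then the algebra of differential operators associated with $W$ is given by $$\mathcal D(w_1\oplus\cdots\oplus w_N)=\sum_{i,j=1}^N\mathcal T_{w_i,w_j}\cdot\mathcal D(w_j)\,E_{i,j},$$ where $E_{i,j}$ are the $N\times N$ matrix units and $\mathcal T_{w_i,w_j}$ are the scalar differential operators defined in the context.
   Context: For a weight matrix $W$ of size $N$ (smooth, positive definite a.e. on an interval, finite moments), $\{P_n\}$ denotes the monic matrix polynomials orthogonal for $\langle P,Q\rangle_W=\int P(x)W(x)Q(x)^*dx$. Differential operators $D=\sum_{j}\partial^jF_j(x)$ with polynomial (matrix) coefficients, forming the algebra $\operatorname{Mat}_N(\Omega[x])$, act on the right: $P\cdot D=\sum_j\partial^j(P)F_j$, and $P\cdot(D_1D_2)=(P\cdot D_1)\cdot D_2$. $\mathcal D(W)=\{D\in\operatorname{Mat}_N(\Omega[x]):\text{for all }n\ge0,\ P_n\cdot D=\Lambda_n(D)P_n\text{ for some }\Lambda_n(D)\in\operatorname{Mat}_N(\mathbb C)\}$. Classical scalar weights: shifted Hermite $w_b(x)=e^{-x^2+2bx}$ on $(-\infty,\infty)$; Laguerre $w_\alpha(x)=e^{-x}x^\alpha$ on $(0,\infty)$, $\alpha>-1$; Jacobi $w_{\alpha,\beta}(x)=(1-x)^\alpha(1+x)^\beta$ on $(-1,1)$, $\alpha,\beta>-1$. Darboux transformations: an operator is degree-preserving if $\deg(P\cdot\mathcal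 V)=\deg P$ for all polynomials $P$; $\tilde w$ is a Darboux transformation of $w$ (same support, monic orthogonal polynomials $\tilde p_n$, $p_n$) if some $D\in\mathcal D(w)$ factors as $D=\mathcal V\mathcal N$ with $\mathcal V,\mathcal N$ degree-preserving operators with polynomial coefficients and $p_n\cdot\mathcal V=a_n\tilde p_n$, $a_n\in\mathbb C$, for all $n\ge0$. For classical weights: $w_a,w_b$ shifted Hermite are equivalent iff $a=b$; Laguerre $w_\alpha,w_{\tilde\alpha}$ iff $\alpha-\tilde\alpha\in\mathbb Z$; Jacobi $w_{\alpha,\beta},w_{\tilde\alpha,\tilde\beta}$ iff $\alpha+\beta=\tilde\alpha+\tilde\beta$ and $\alpha-\tilde\alpha\in\mathbb Z$. The operators $\mathcal T_{w,\tilde w}$: (i) $\mathcal T_{w,\tilde w}=1$ if $w=\tilde w$, and $\mathcal T_{w,\tilde w}=0$ if $w$ is not a Darboux transformation of $\tilde w$. (ii) For Laguerre weights and $k\in\mathbb N$: $\mathcal T_{w_\alpha,w_{\alpha+k}}=(-\partial+1)^k$ and $\mathcal T_{w_{\alpha+k},w_\alpha}=(\partial x+\alpha+k)(\partial x+\alpha+k-1)\cdots(\partial x+\alpha+1)$. (iii) For Jacobi weights and $k\in\mathbb N$: $\mathcal T_{w_{\alpha,\beta+k},w_{\alpha+k,\beta}}=(\partial(1+x)+\beta+k)\cdots(\partial(1+x)+\beta+1)$ and $\mathcal T_{w_{\alpha+k,\beta},w_{\alpha,\beta+k}}=(\partial(x-1)+\alpha+k)\cdots(\partial(x-1)+\alpha+1)$.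 *)

theory Defs
  imports
    "HOL-Analysis.Analysis"
    "HOL-Computational_Algebra.Polynomial"
begin

section \<open>Scalar polynomials and differential operators\<close>

text \<open>
  An element of \<open>\<Omega>[x]\<close> is identified with the linear map \<open>p \<mapsto> p \<cdot> L\<close> it induces
  on \<open>\<complex>[x]\<close>; the action is faithful, so no information is lost. Operators act on the right, with
  the coefficients to the right of the powers of \<open>\<partial>\<close>.
\<close>

type_synonym scalar_op = "complex poly \<Rightarrow> complex poly"

definition scalar_ops :: "scalar_op set" where
  "scalar_ops = {L. \<exists>m (F :: nat \<Rightarrow> complex poly). L = (\<lambda>p. \<Sum>k\<le>m. (pderiv ^^ k) p * F k)}"

text \<open>Right action: \<open>p \<cdot> (L\<^sub>1 L\<^sub>2) = (p \<cdot> L\<^sub>1) \<cdot> L\<^sub>2\<close>, so the left factor is applied first.\<close>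

definition op_mult :: "scalar_op \<Rightarrow> scalar_op \<Rightarrow> scalar_op" (infixl "\<odot>" 70) where
  "L \<odot> M = (\<lambda>p. M (L p))"

definition op_prod :: "scalar_op list \<Rightarrow> scalar_op" where
  "op_prod Ls = foldr (\<odot>) Ls id"

text \<open>The first-order operator \<open>\<partial> f(x) + c\<close>.\<close>

definition first_order :: "complex poly \<Rightarrow> real \<Rightarrow> scalar_op" where
  "first_order f c = (\<lambda>p. pderiv p * f + smult (complex_of_real c) p)"

text \<open>
  The zero polynomial has degree \<open>-\<infinity>\<close> mathematically but \<open>degree 0 = 0\<close> in the library, hence the
  explicit nonvanishing clause.
\<close>

definition degree_preserving :: "scalar_op \<Rightarrow> bool" where
  "degree_preserving L \<longleftrightarrow> (\<forall>p. p \<noteq> 0 \<longrightarrow> L p \<noteq> 0 \<and> degree (L p) = degree p)"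


section \<open>Scalar weights\<close>

text \<open>A weight on an interval is represented by its extension by zero to the real line.\<close>

definition scalar_inner :: "(real \<Rightarrow> real) \<Rightarrow> complex poly \<Rightarrow> complex poly \<Rightarrow> complex" where
  "scalar_inner w p q =
     (\<integral>x. poly p (complex_of_real x) * complex_of_real (w x) * cnj (poly q (complex_of_real x)) \<partial>lborel)"

definition is_scalar_mops :: "(real \<Rightarrow> real) \<Rightarrow> (nat \<Rightarrow> complex poly) \<Rightarrow> bool" where
  "is_scalar_mops w p \<longleftrightarrow>
     (\<forall>n. degree (p n) = n \<and> lead_coeff (p n) = 1) \<and>
     (\<forall>n m. n \<noteq> m \<longrightarrow> scalar_inner w (p n) (p m) = 0)"

definition scalar_mops :: "(real \<Rightarrow> real) \<Rightarrow> nat \<Rightarrow> complex poly" where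
  "scalar_mops w = (THE p. is_scalar_mops w p)"

definition scalar_D :: "(real \<Rightarrow> real) \<Rightarrow> scalar_op set" where
  "scalar_D w = {L \<in> scalar_ops. \<forall>n. \<exists>c. L (scalar_mops w n) = smult c (scalar_mops w n)}"

text \<open>\<open>darboux_transformation w w'\<close>: the weight \<open>w'\<close> is a Darboux transformation of \<open>w\<close>.\<close>

definition darboux_transformation :: "(real \<Rightarrow> real) \<Rightarrow> (real \<Rightarrow> real) \<Rightarrow> bool" where
  "darboux_transformation w w' \<longleftrightarrow>
     closure {x. w x \<noteq> 0} = closure {x. w' x \<noteq> 0} \<and>
     (\<exists>V\<in>scalar_ops. \<exists>N\<in>scalar_ops.
        degree_preserving V \<and> degree_preserving N \<and> V \<odot> N \<in> scalar_D w \<and>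
        (\<forall>n. \<exists>a. V (scalar_mops w n) = smult a (scalar_mops w' n)))"


section \<open>Classical weights\<close>

datatype classical_weight = Hermite real | Laguerre real | Jacobi real real

fun admissible :: "classical_weight \<Rightarrow> bool" where
  "admissible (Hermite b) \<longleftrightarrow> True"
| "admissible (Laguerre a) \<longleftrightarrow> a > -1"
| "admissible (Jacobi a b) \<longleftrightarrow> a > -1 \<and> b > -1"

fun same_type :: "classical_weight \<Rightarrow> classical_weight \<Rightarrow> bool" where
  "same_type (Hermite _) (Hermite _) \<longleftrightarrow> True"
| "same_type (Laguerre _) (Laguerre _) \<longleftrightarrow> True"
| "same_type (Jacobi _ _) (Jacobi _ _) \<longleftrightarrow> True"
| "same_type _ _ \<longleftrightarrow> False"

fun weight :: "classical_weight \<Rightarrow> real \<Rightarrow> real" where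
  "weight (Hermite b) x = exp (- x\<^sup>2 + 2 * b * x)"
| "weight (Laguerre a) x = (if 0 < x then exp (- x) * x powr a else 0)"
| "weight (Jacobi a b) x = (if -1 < x \<and> x < 1 then (1 - x) powr a * (1 + x) powr b else 0)"

text \<open>
  The explicit operators for distinct Darboux-equivalent weights, whose parameters differ by an
  integer. All other argument pairs are junk here; they are never used in \<open>T_op\<close> below.
\<close>

fun explicit_T :: "classical_weight \<Rightarrow> classical_weight \<Rightarrow> scalar_op" where
  "explicit_T (Laguerre a) (Laguerre a') =
     (if a < a' then (\<lambda>p. - pderiv p + p) ^^ nat \<lfloor>a' - a\<rfloor>
      else op_prod (map (\<lambda>i. first_order [:0, 1:] (a' + real i)) (rev [1..<Suc (nat \<lfloor>a - a'\<rfloor>)])))"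
| "explicit_T (Jacobi a b) (Jacobi a' b') =
     (if a < a'
      then op_prod (map (\<lambda>i. first_order [:1, 1:] (b' + real i)) (rev [1..<Suc (nat \<lfloor>a' - a\<rfloor>)]))
      else op_prod (map (\<lambda>i. first_order [:-1, 1:] (a' + real i)) (rev [1..<Suc (nat \<lfloor>a - a'\<rfloor>)])))"
| "explicit_T _ _ = (\<lambda>_. 0)"

lemma explicit_T_Laguerre:
  "explicit_T (Laguerre a) (Laguerre (a + real k)) = (\<lambda>p. - pderiv p + p) ^^ k"
  "explicit_T (Laguerre (a + real k)) (Laguerre a) =
     op_prod (map (\<lambda>i. first_order [:0, 1:] (a + real i)) (rev [1..<Suc k]))"
  by (simp_all add: op_prod_def id_def)

lemma explicit_T_Jacobi:
  "explicit_T (Jacobi a (b + real k)) (Jacobi (a + real k) b) =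
     op_prod (map (\<lambda>i. first_order [:1, 1:] (b + real i)) (rev [1..<Suc k]))"
  "explicit_T (Jacobi (a + real k) b) (Jacobi a (b + real k)) =
     op_prod (map (\<lambda>i. first_order [:-1, 1:] (a + real i)) (rev [1..<Suc k]))"
  by (simp_all add: op_prod_def)

definition T_op :: "classical_weight \<Rightarrow> classical_weight \<Rightarrow> scalar_op" where
  "T_op w w' =
     (if w = w' then id
      else if \<not> darboux_transformation (weight w') (weight w) then (\<lambda>_. 0)
      else explicit_T w w')"


section \<open>Matrix polynomials, matrix operators and matrix weights\<close>

type_synonym 'n matpoly = "complex poly ^'n ^'n"
type_synonym 'n mat_op = "'n matpoly \<Rightarrow> 'n matpoly"

definition mat_pderiv :: "'n::finite matpoly \<Rightarrow> 'n matpoly" where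
  "mat_pderiv P = (\<chi> i j. pderiv (P $ i $ j))"

definition mat_coeff :: "'n::finite matpoly \<Rightarrow> nat \<Rightarrow> complex ^'n ^'n" where
  "mat_coeff P k = (\<chi> i j. coeff (P $ i $ j) k)"

definition mat_const :: "complex ^'n ^'n \<Rightarrow> 'n::finite matpoly" where
  "mat_const A = (\<chi> i j. [:A $ i $ j:])"

definition mat_eval :: "'n::finite matpoly \<Rightarrow> real \<Rightarrow> complex ^'n ^'n" where
  "mat_eval P x = (\<chi> i j. poly (P $ i $ j) (complex_of_real x))"

definition mat_adjoint :: "complex ^'n ^'n \<Rightarrow> complex ^'n ^'n::finite" where
  "mat_adjoint A = (\<chi> i j. cnj (A $ j $ i))"

text \<open>As in the scalar case, an element of \<open>Mat\<^sub>N(\<Omega>[x])\<close> is identified with its right action.\<close>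

definition mat_ops :: "'n::finite mat_op set" where
  "mat_ops = {D. \<exists>m (F :: nat \<Rightarrow> 'n matpoly). D = (\<lambda>P. \<Sum>k\<le>m. (mat_pderiv ^^ k) P ** F k)}"

definition mat_inner ::
    "(real \<Rightarrow> complex ^'n ^'n) \<Rightarrow> 'n matpoly \<Rightarrow> 'n matpoly \<Rightarrow> complex ^'n ^'n::finite" where
  "mat_inner W P Q = (\<integral>x. mat_eval P x ** W x ** mat_adjoint (mat_eval Q x) \<partial>lborel)"

definition is_mat_mops ::
    "(real \<Rightarrow> complex ^'n ^'n) \<Rightarrow> (nat \<Rightarrow> 'n::finite matpoly) \<Rightarrow> bool" where
  "is_mat_mops W P \<longleftrightarrow>
     (\<forall>n. mat_coeff (P n) n = mat 1 \<and> (\<forall>k>n. mat_coeff (P n) k = 0)) \<and>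
     (\<forall>n m. n \<noteq> m \<longrightarrow> mat_inner W (P n) (P m) = 0)"

definition mat_mops :: "(real \<Rightarrow> complex ^'n ^'n) \<Rightarrow> nat \<Rightarrow> 'n::finite matpoly" where
  "mat_mops W = (THE P. is_mat_mops W P)"

definition mat_D :: "(real \<Rightarrow> complex ^'n ^'n) \<Rightarrow> 'n::finite mat_op set" where
  "mat_D W = {D \<in> mat_ops. \<forall>n. \<exists>\<Lambda>. D (mat_mops W n) = mat_const \<Lambda> ** mat_mops W n}"

definition direct_sum :: "('n \<Rightarrow> classical_weight) \<Rightarrow> real \<Rightarrow> complex ^'n ^'n::finite" where
  "direct_sum w x = (\<chi> i j. if i = j then complex_of_real (weight (w i) x) else 0)"

definition matrix_unit :: "'n::finite \<Rightarrow> 'n \<Rightarrow> 'n matpoly" where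
  "matrix_unit i j = (\<chi> r s. if r = i \<and> s = j then 1 else 0)"

text \<open>The matrix operator \<open>L E\<^sub>i\<^sub>,\<^sub>j\<close> for a scalar operator \<open>L\<close>.\<close>

definition op_unit :: "scalar_op \<Rightarrow> 'n::finite \<Rightarrow> 'n \<Rightarrow> 'n mat_op" where
  "op_unit L i j = (\<lambda>P. (\<chi> r s. L (P $ r $ s)) ** matrix_unit i j)"

end

theory Submission
  imports Defs "HOL-Probability.Distributions" "HOL-Real_Asymp.Real_Asymp"
begin

text \<open>
  The monic orthogonal polynomials of a diagonal weight are the diagonal matrices built from the
  scalar sequences \<open>p\<^sub>n\<^sup>(\<^sup>i\<^sup>)\<close>, so an operator with entries \<open>L\<^sub>i\<^sub>j\<close> belongs to \<open>\<D>(W)\<close> exactly when each entry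
  intertwines, that is, maps every \<open>p\<^sub>n\<^sup>(\<^sup>i\<^sup>)\<close> to a multiple of \<open>p\<^sub>n\<^sup>(\<^sup>j\<^sup>)\<close> (\<open>mat_D_diag\<close>). What remains is a
  statement about two scalar weights of the same type: the operators intertwining \<open>w\<close> with \<open>w'\<close>
  form \<open>T\<^sub>w\<^sub>,\<^sub>w\<^sub>' \<cdot> \<D>(w')\<close> (\<open>scalar_intertwiners\<close>).

  For a classical weight the \<open>p\<^sub>n\<close> are the eigenfunctions of \<open>\<delta> = \<partial>\<^sup>2a + \<partial>b\<close>, where \<open>(aw)' = bw\<close>, with
  pairwise distinct eigenvalues \<open>\<lambda>\<^sub>n\<close> (\<open>classical_pearson\<close>, \<open>mops_eigen\<close>). The multipliers \<open>c\<^sub>n\<close> of an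
  intertwining operator, \<open>p\<^sub>n \<cdot> L = c\<^sub>n q\<^sub>n\<close>, can be read off in two ways, each of which shows that
  they are essentially polynomial.

  \<^item> At infinity: comparing leading coefficients, \<open>c\<^sub>n\<close> is a polynomial in \<open>n\<close>
    (\<open>leading_coefficient_polynomial\<close>).
  \<^item> At a zero \<open>x\<^sub>0\<close> of \<open>a\<close>: there the differential equation expresses all derivatives of \<open>p\<^sub>n\<close> by
    \<open>p\<^sub>n(x\<^sub>0)\<close> and polynomials in \<open>\<lambda>\<^sub>n\<close>, hence \<open>c\<^sub>n q\<^sub>n(x\<^sub>0) = e(\<lambda>\<^sub>n) p\<^sub>n(x\<^sub>0)\<close> for a polynomial \<open>e\<close>
    (\<open>op_at_singular_point\<close>).

  Suppose that the parameters are equivalent. Each explicit operator \<open>T\<close> satisfies \<open>\<delta>T = T\<delta>'\<close>, hence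
  intertwines, and at one of these points its own multiplier is trivial: \<open>(-\<partial> + 1)\<^sup>k\<close> preserves
  leading coefficients, and the products of factors \<open>\<partial>f + c\<close> multiply the value at the zero of \<open>f\<close> by
  a nonzero constant. Comparing \<open>L\<close> with \<open>T\<close> at that point gives \<open>L = T \<cdot> e(\<delta>')\<close> for a polynomial \<open>e\<close>,
  and \<open>e(\<delta>')\<close> lies in \<open>\<D>(w')\<close> (\<open>factor_through\<close>, \<open>explicit_T_properties\<close>). So divisibility by \<open>T\<close>
  comes from choosing the right point.

  Suppose that the parameters are not equivalent. Then \<open>L = 0\<close> (\<open>no_intertwiner_inequivalent\<close>), for a
  reason that depends on the family. In the Laguerre case, and in the Jacobi case with
  \<open>\<alpha> + \<beta> = \<alpha>' + \<beta>'\<close>, comparing the multipliers at two points makes a quotient of Pochhammer symbols a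
  rational function of \<open>n\<close> unless \<open>L = 0\<close>. Its growth exponent, which is \<open>\<alpha> - \<alpha>'\<close> for Laguerre and
  \<open>2(\<alpha> - \<alpha>')\<close> for Jacobi weights, would be an integer and an even integer, respectively.
  In the Jacobi case with \<open>\<alpha> + \<beta> \<noteq> \<alpha>' + \<beta>'\<close>, evaluating \<open>L\<close> and \<open>L\<partial>\<close> at the same point gives
  \<open>n e(\<lambda>\<^sub>n) = h(\<lambda>\<^sub>n)\<close>, impossible for \<open>e \<noteq> 0\<close> because \<open>\<lambda>\<^sub>n\<close> is quadratic in \<open>n\<close>. In the Hermite case the
  two sequences are translates of each other, so \<open>L\<close> would be a differential operator followed by a
  translation.

  A Darboux transformation provides a nonzero intertwining operator, so it exists only between
  weights with equivalent parameters; conversely the two explicit operators provide one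
  (\<open>darboux_iff_equivalent\<close>). Thus the case distinction in the definition of \<open>T\<^sub>w\<^sub>,\<^sub>w\<^sub>'\<close> is the one above.
\<close>

section \<open>The algebra of scalar differential operators\<close>

lemma smult_sum_right: "smult c (\<Sum>x\<in>A. f x) = (\<Sum>x\<in>A. smult c (f x))"
  by (induction A rule: infinite_finite_induct) (simp_all add: smult_add_right)

lemma pderiv_sum: "pderiv (\<Sum>x\<in>A. f x) = (\<Sum>x\<in>A. pderiv (f x))"
  using higher_pderiv_sum[of 1 f A] by simp

text \<open>
  Linearity over \<open>\<complex>\<close>, stated for arbitrary self-maps of \<open>\<complex>[x]\<close> so that it also covers translations
  \<open>p(x) \<mapsto> p(x + h)\<close>, which are not differential operators when \<open>h \<noteq> 0\<close>.
\<close>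

definition poly_linear :: "scalar_op \<Rightarrow> bool" where
  "poly_linear L \<longleftrightarrow> (\<forall>p q. L (p + q) = L p + L q) \<and> (\<forall>c p. L (smult c p) = smult c (L p))"

lemma poly_linearI:
  "\<lbrakk>\<And>p q. L (p + q) = L p + L q; \<And>c p. L (smult c p) = smult c (L p)\<rbrakk> \<Longrightarrow> poly_linear L"
  by (simp add: poly_linear_def)

lemma
  assumes "poly_linear L"
  shows poly_linear_add: "L (p + q) = L p + L q"
    and poly_linear_smult: "L (smult c p) = smult c (L p)"
    and poly_linear_0: "L 0 = 0"
    and poly_linear_diff: "L (p - q) = L p - L q"
proof -
  show add: "L (p + q) = L p + L q" and smult: "L (smult c p) = smult c (L p)" for p q c
    using assms by (auto simp: poly_linear_def)
  show "L 0 = 0" using smult[of 0 0] by simp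
  have minus: "L (- p) = - L p" for p using smult[of "-1" p] by simp
  show "L (p - q) = L p - L q" using add[of p "-q"] by (simp add: minus)
qed

lemma poly_linear_sum:
  assumes "poly_linear L" shows "L (sum f A) = (\<Sum>x\<in>A. L (f x))"
  by (induction A rule: infinite_finite_induct)
     (simp_all add: poly_linear_0[OF assms] poly_linear_add[OF assms])

lemma scalar_ops_linear:
  assumes "L \<in> scalar_ops" shows "poly_linear L"
  using assms
  by (auto simp: scalar_ops_def poly_linear_def higher_pderiv_add higher_pderiv_smult
        algebra_simps sum.distrib smult_sum_right)

text \<open>
  Extending the coefficients by zero beyond the order lets operators of different orders be written
  with a common bound of summation.
\<close>

lemma scalar_opsE:
  assumes "L \<in> scalar_ops"
  obtains m and F :: "nat \<Rightarrow> complex poly"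
  where "L = (\<lambda>p. \<Sum>k\<le>m. (pderiv ^^ k) p * F k)" "\<And>k. k > m \<Longrightarrow> F k = 0"
proof -
  from assms obtain m F where F: "L = (\<lambda>p. \<Sum>k\<le>m. (pderiv ^^ k) p * F k)"
    by (auto simp: scalar_ops_def)
  show thesis
    by (rule that[where m = m and F = "\<lambda>k. if k \<le> m then F k else 0"]) (auto simp: F)
qed

lemma scalar_ops_pad:
  assumes "\<And>k. k > m \<Longrightarrow> F k = 0" "m \<le> n"
  shows "(\<Sum>k\<le>m. (pderiv ^^ k) p * F k) = (\<Sum>k\<le>n. (pderiv ^^ k) p * (F k :: complex poly))"
  using assms by (intro sum.mono_neutral_left) auto

lemma scalar_opsI: "(\<And>p. L p = (\<Sum>k\<le>m. (pderiv ^^ k) p * F k)) \<Longrightarrow> L \<in> scalar_ops"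
  by (auto simp: scalar_ops_def)

lemma scalar_ops_zero: "(\<lambda>_. 0) \<in> scalar_ops"
  by (rule scalar_opsI[where m=0 and F="\<lambda>_. 0"]) simp

lemma scalar_ops_id: "(\<lambda>p. p) \<in> scalar_ops"
  by (rule scalar_opsI[where m=0 and F="\<lambda>_. 1"]) simp

lemma scalar_ops_plus:
  assumes "L \<in> scalar_ops" "M \<in> scalar_ops"
  shows "(\<lambda>p. L p + M p) \<in> scalar_ops"
proof -
  obtain m F where F: "L = (\<lambda>p. \<Sum>k\<le>m. (pderiv ^^ k) p * F k)" "\<And>k. k > m \<Longrightarrow> F k = 0"
    using assms(1) by (rule scalar_opsE) blast
  obtain n G where G: "M = (\<lambda>p. \<Sum>k\<le>n. (pderiv ^^ k) p * G k)" "\<And>k. k > n \<Longrightarrow> G k = 0"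
    using assms(2) by (rule scalar_opsE) blast
  show ?thesis
  proof (rule scalar_opsI)
    fix p
    show "L p + M p = (\<Sum>k\<le>max m n. (pderiv ^^ k) p * (F k + G k))"
      using scalar_ops_pad[where m = m and F = F and n = "max m n" and p = p]
        scalar_ops_pad[where m = n and F = G and n = "max m n" and p = p] F(2) G(2)
      by (simp add: F(1) G(1) distrib_left sum.distrib)
  qed
qed

lemma scalar_ops_times:
  assumes "L \<in> scalar_ops" shows "(\<lambda>p. L p * g) \<in> scalar_ops"
proof -
  obtain m F where F: "L = (\<lambda>p. \<Sum>k\<le>m. (pderiv ^^ k) p * F k)"
    using assms by (rule scalar_opsE) blast
  show ?thesis
    by (rule scalar_opsI[where m=m and F="\<lambda>k. F k * g"]) (simp add: F sum_distrib_right mult.assoc)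
qed

lemma scalar_ops_smult: "L \<in> scalar_ops \<Longrightarrow> (\<lambda>p. smult c (L p)) \<in> scalar_ops"
  using scalar_ops_times[of L "[:c:]"] by simp

lemma scalar_ops_uminus: "L \<in> scalar_ops \<Longrightarrow> (\<lambda>p. - L p) \<in> scalar_ops"
  using scalar_ops_smult[of L "-1"] by simp

lemma scalar_ops_sum:
  "(\<And>x. x \<in> A \<Longrightarrow> L x \<in> scalar_ops) \<Longrightarrow> (\<lambda>p. \<Sum>x\<in>A. L x p) \<in> scalar_ops"
  by (induction A rule: infinite_finite_induct) (auto intro: scalar_ops_plus scalar_ops_zero)

lemma scalar_ops_pderiv:
  assumes "L \<in> scalar_ops" shows "(\<lambda>p. pderiv (L p)) \<in> scalar_ops"
proof -
  obtain m F where F: "L = (\<lambda>p. \<Sum>k\<le>m. (pderiv ^^ k) p * F k)"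
    using assms by (rule scalar_opsE) blast
  have mono: "(\<lambda>p. (pderiv ^^ k) p * G) \<in> scalar_ops" for k and G :: "complex poly"
    by (rule scalar_opsI[where m=k and F="\<lambda>j. if j = k then G else 0"]) (simp add: if_distrib cong: if_cong)
  have "(\<lambda>p. \<Sum>k\<le>m. ((pderiv ^^ k) p * pderiv (F k) + (pderiv ^^ Suc k) p * F k)) \<in> scalar_ops"
    by (intro scalar_ops_sum scalar_ops_plus mono)
  also have "(\<lambda>p. \<Sum>k\<le>m. ((pderiv ^^ k) p * pderiv (F k) + (pderiv ^^ Suc k) p * F k))
              = (\<lambda>p. pderiv (L p))"
    by (rule ext) (simp add: F pderiv_sum pderiv_mult algebra_simps)
  finally show ?thesis .
qed

lemma scalar_ops_compose:
  assumes "L \<in> scalar_ops" "M \<in> scalar_ops" shows "L \<odot> M \<in> scalar_ops"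
proof -
  obtain m F where F: "M = (\<lambda>p. \<Sum>k\<le>m. (pderiv ^^ k) p * F k)"
    using assms(2) by (rule scalar_opsE) blast
  have "(\<lambda>p. (pderiv ^^ k) (L p)) \<in> scalar_ops" for k
    by (induction k) (auto intro: assms(1) scalar_ops_pderiv)
  then show ?thesis
    unfolding op_mult_def F by (intro scalar_ops_sum scalar_ops_times)
qed

lemma scalar_ops_funpow: "L \<in> scalar_ops \<Longrightarrow> L ^^ k \<in> scalar_ops"
proof (induction k)
  case 0 show ?case using scalar_ops_id by (simp add: id_def)
next
  case (Suc k)
  have "L ^^ Suc k = (L ^^ k) \<odot> L" by (auto simp: op_mult_def)
  then show ?case using Suc scalar_ops_compose by simp
qed

lemma scalar_ops_first_order: "first_order f c \<in> scalar_ops"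
  unfolding first_order_def
  by (intro scalar_ops_plus scalar_ops_smult scalar_ops_times scalar_ops_pderiv scalar_ops_id)

lemma scalar_ops_op_prod: "(\<And>L. L \<in> set Ls \<Longrightarrow> L \<in> scalar_ops) \<Longrightarrow> op_prod Ls \<in> scalar_ops"
proof (induction Ls)
  case Nil show ?case using scalar_ops_id by (simp add: op_prod_def id_def)
next
  case (Cons L Ls) then show ?case by (simp add: op_prod_def scalar_ops_compose)
qed

definition op_poly :: "complex poly \<Rightarrow> scalar_op \<Rightarrow> scalar_op" where
  "op_poly e D = (\<lambda>p. \<Sum>k\<le>degree e. smult (coeff e k) ((D ^^ k) p))"

lemma scalar_ops_op_poly: "D \<in> scalar_ops \<Longrightarrow> op_poly e D \<in> scalar_ops"
  unfolding op_poly_def by (intro scalar_ops_sum scalar_ops_smult scalar_ops_funpow)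

text \<open>
  Every element of \<open>\<D>(w)\<close> needed below is produced in this way from the second-order operator: its
  eigenvalues are then a prescribed polynomial in \<open>\<lambda>\<^sub>n\<close>.
\<close>

lemma op_poly_eigen:
  assumes "poly_linear D" "D p = smult l p"
  shows "op_poly e D p = smult (poly e l) p"
proof -
  have "(D ^^ k) p = smult (l ^ k) p" for k
    by (induction k) (simp_all add: poly_linear_smult[OF assms(1)] assms(2) mult.commute)
  then show ?thesis by (simp add: op_poly_def poly_altdef smult_sum)
qed

section \<open>Polynomial sequences with one member in each degree\<close>

lemma monic_sequence_expand:
  fixes p :: "nat \<Rightarrow> complex poly"
  assumes "\<And>n. degree (p n) = n" "\<And>n. lead_coeff (p n) = 1"
    and "\<And>k. k \<ge> n \<Longrightarrow> coeff r k = 0"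
  shows "\<exists>b. r = (\<Sum>k<n. smult (b k) (p k))"
  using assms(3)
proof (induction n arbitrary: r)
  case 0
  then have "r = 0" by (intro poly_eqI) simp
  then show ?case by simp
next
  case (Suc n)
  define s where "s = r - smult (coeff r n) (p n)"
  have "coeff s k = 0" if "k \<ge> n" for k
  proof (cases "k = n")
    case True then show ?thesis using assms(1,2)[of n] by (simp add: s_def)
  next
    case False
    then show ?thesis using that Suc.prems[of k] assms(1)[of n] by (simp add: s_def coeff_eq_0)
  qed
  then obtain b where "s = (\<Sum>k<n. smult (b k) (p k))" using Suc.IH by blast
  then have "r = (\<Sum>k<Suc n. smult ((b(n := coeff r n)) k) (p k))"
    by (simp add: s_def algebra_simps)
  then show ?case by blast
qed

lemma linear_eq_on_monic_sequence:
  assumes "\<And>n. degree (p n) = n" "\<And>n. lead_coeff (p n) = 1"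
    and "poly_linear L" "poly_linear M" "\<And>n. L (p n) = M (p n)"
  shows "L = M"
proof
  fix r
  obtain b where "r = (\<Sum>k<Suc (degree r). smult (b k) (p k))"
    using monic_sequence_expand[OF assms(1,2), of "Suc (degree r)" r] by (auto simp: coeff_eq_0)
  moreover have "K r = (\<Sum>k<Suc (degree r). smult (b k) (K (p k)))"
    if "poly_linear K" "r = (\<Sum>k<Suc (degree r). smult (b k) (p k))" for K
    by (subst that(2)) (simp only: poly_linear_sum[OF that(1)] poly_linear_smult[OF that(1)])
  ultimately have "K r = (\<Sum>k<Suc (degree r). smult (b k) (K (p k)))" if "poly_linear K" for K
    using that by blast
  from this[OF assms(3)] this[OF assms(4)] show "L r = M r"
    by (simp add: assms(5))
qed

text \<open>
  The coefficient of \<open>x\<^sup>n\<close> in \<open>x\<^sup>n \<cdot> \<partial>\<^sup>kF\<close> is \<open>n(n-1)\<dots>(n-k+1)\<close> times the coefficient of \<open>x\<^sup>k\<close> in \<open>F\<close>; the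
  falling factorial also gives the correct value \<open>0\<close> when \<open>n < k\<close>.
\<close>

lemma diagonal_coefficient_polynomial:
  fixes L :: scalar_op
  assumes L: "L = (\<lambda>p. \<Sum>k\<le>m. (pderiv ^^ k) p * F k)"
  shows "\<exists>C. \<forall>n. coeff (L (monom 1 n)) n = poly C (of_nat n)"
proof -
  define C where "C = (\<Sum>k\<le>m. smult (coeff (F k) k) (\<Prod>i<k. [:- of_nat i, 1:]))"
  have pz: "(\<Prod>i<k. of_nat n - of_nat i) = (0::complex)" if "n < k" for n k
    using that by (intro prod_zero) auto
  have *: "(pderiv ^^ k) (monom (1::complex) n) = monom (\<Prod>i<k. of_nat n - of_nat i) (n - k)"
    for k n
  proof (induction k)
    case (Suc k)
    show ?case
    proof (cases "n < k")
      case True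
      then show ?thesis by (simp add: Suc.IH pderiv_monom pz[OF True])
    next
      case False
      then have "complex_of_nat (n - k) = of_nat n - of_nat k" by (simp add: of_nat_diff)
      then show ?thesis by (simp add: Suc.IH pderiv_monom mult.commute)
    qed
  qed simp
  have "coeff ((pderiv ^^ k) (monom 1 n) * F k) n = (\<Prod>i<k. of_nat n - of_nat i) * coeff (F k) k" for k n
  proof (cases "k \<le> n")
    case True then show ?thesis unfolding * by (simp add: coeff_monom_mult)
  next
    case False then show ?thesis unfolding * by (subst (1 2) pz) simp_all
  qed
  then have "coeff (L (monom 1 n)) n = poly C (of_nat n)" for n
    by (simp add: L C_def coeff_sum poly_sum poly_prod mult.commute)
  then show ?thesis by blast
qed

section \<open>Hypergeometric operators\<close>

definition hyper_op :: "complex poly \<Rightarrow> complex poly \<Rightarrow> scalar_op" where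
  "hyper_op a b = (\<lambda>p. pderiv (pderiv p) * a + pderiv p * b)"

lemma scalar_ops_hyper_op: "hyper_op a b \<in> scalar_ops"
  unfolding hyper_op_def
  by (intro scalar_ops_plus scalar_ops_times scalar_ops_pderiv scalar_ops_id)

lemmas hyper_op_linear = scalar_ops_linear[OF scalar_ops_hyper_op]

definition hyper_eigenvalue :: "complex poly \<Rightarrow> complex poly \<Rightarrow> nat \<Rightarrow> complex" where
  "hyper_eigenvalue a b n = of_nat n * (of_nat n - 1) * coeff a 2 + of_nat n * coeff b 1"

lemma coeff_mult_top:
  fixes p q :: "'a::comm_semiring_1 poly"
  assumes "degree p \<le> i" "degree q \<le> j"
  shows "coeff (p * q) (i + j) = coeff p i * coeff q j"
proof -
  have "coeff (p * q) (i + j) = (\<Sum>k\<le>i+j. coeff p k * coeff q (i + j - k))"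
    by (simp add: coeff_mult)
  also have "\<dots> = (\<Sum>k\<in>{i}. coeff p k * coeff q (i + j - k))"
  proof (intro sum.mono_neutral_right ballI)
    fix k assume "k \<in> {..i + j} - {i}"
    then have "degree p < k \<or> degree q < i + j - k" using assms by auto
    then show "coeff p k * coeff q (i + j - k) = 0" by (auto simp: coeff_eq_0)
  qed auto
  finally show ?thesis by simp
qed

text \<open>
  The degree bounds make the operator triangular in the basis of monomials. The bound \<open>n\<close> may
  exceed the degree of \<open>r\<close>, so the lemma also says that degrees do not grow.
\<close>

lemma coeff_hyper_op_top:
  assumes "degree a \<le> 2" "degree b \<le> 1" "degree r \<le> n"
  shows "coeff (hyper_op a b r) n = hyper_eigenvalue a b n * coeff r n"
proof -
  have d: "degree (pderiv r) \<le> n - 1" using assms by (simp add: degree_pderiv)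
  have dd: "degree (pderiv (pderiv r)) \<le> n - 2" using assms by (simp add: degree_pderiv)
  consider "n = 0" | "n = 1" | m where "n = m + 2"
    by (metis add_2_eq_Suc' less_2_cases_iff not_less_eq_eq numeral_2_eq_2 le_add_diff_inverse2
        One_nat_def less_one linorder_not_less)
  then show ?thesis
  proof cases
    case 1
    then have "pderiv r = 0" using assms by (simp add: pderiv_eq_0_iff)
    then show ?thesis by (simp add: hyper_op_def hyper_eigenvalue_def 1)
  next
    case 2
    then have "pderiv (pderiv r) = 0" using d by (simp add: pderiv_eq_0_iff)
    then show ?thesis
      using coeff_mult_top[of "pderiv r" 0 b 1] d assms(2)
      by (simp add: hyper_op_def hyper_eigenvalue_def 2 coeff_pderiv)
  next
    case (3 m)
    have "coeff (pderiv (pderiv r) * a) (m + 2) = coeff (pderiv (pderiv r)) m * coeff a 2"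
      by (rule coeff_mult_top) (use dd assms(1) 3 in auto)
    moreover have "coeff (pderiv r * b) (Suc m + 1) = coeff (pderiv r) (Suc m) * coeff b 1"
      by (rule coeff_mult_top) (use d assms(2) 3 in auto)
    ultimately show ?thesis
      by (simp add: hyper_op_def hyper_eigenvalue_def 3 coeff_pderiv algebra_simps)
  qed
qed

text \<open>
  A polynomial eigenbasis of a hypergeometric operator, without reference to a weight: everything
  about intertwining operators is algebra and uses only these axioms.
\<close>

locale hypergeometric_system =
  fixes a b :: "complex poly" and p :: "nat \<Rightarrow> complex poly"
  assumes degree_a: "degree a \<le> 2" and degree_b: "degree b \<le> 1"
    and inj_eigenvalue: "inj (hyper_eigenvalue a b)"
    and degree_p [simp]: "degree (p n) = n"
    and lead_p: "lead_coeff (p n) = 1"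
    and eigen: "hyper_op a b (p n) = smult (hyper_eigenvalue a b n) (p n)"
begin

abbreviation "\<delta> \<equiv> hyper_op a b"
abbreviation "eig \<equiv> hyper_eigenvalue a b"

lemma coeff_p_top [simp]: "coeff (p n) n = 1"
  using lead_p[of n] by simp

lemmas expand = monic_sequence_expand[of p, OF degree_p lead_p]
lemmas eq_on_p = linear_eq_on_monic_sequence[of p, OF degree_p lead_p]

text \<open>
  The eigenvalue determines the degree by triangularity, so subtracting a multiple of \<open>p\<^sub>n\<close> from an
  eigenfunction leaves one of the wrong degree, namely \<open>0\<close>.
\<close>

lemma eigenspace:
  assumes "\<delta> r = smult (eig n) r"
  shows "r = smult (coeff r n) (p n)"
proof -
  have deg: "degree s = n" if "\<delta> s = smult (eig n) s" "s \<noteq> 0" for s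
  proof -
    have "eig (degree s) * lead_coeff s = eig n * lead_coeff s"
      by (simp only: coeff_hyper_op_top[OF degree_a degree_b order_refl, symmetric] that(1) coeff_smult)
    then have "eig (degree s) = eig n" using that(2) by auto
    then show ?thesis using inj_eigenvalue by (simp add: inj_eq)
  qed
  define s where "s = r - smult (coeff r n) (p n)"
  have "\<delta> s = smult (eig n) s"
    by (simp add: s_def poly_linear_diff[OF hyper_op_linear] poly_linear_smult[OF hyper_op_linear]
        assms eigen smult_diff_right mult.commute)
  moreover have "coeff s n = 0" by (simp add: s_def)
  ultimately have "s = 0" using deg by (metis leading_coeff_0_iff)
  then show ?thesis by (simp add: s_def)
qed

end

definition intertwines :: "scalar_op \<Rightarrow> (nat \<Rightarrow> complex poly) \<Rightarrow> (nat \<Rightarrow> complex poly) \<Rightarrow> bool" where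
  "intertwines L p q \<longleftrightarrow> (\<forall>n. \<exists>c. L (p n) = smult c (q n))"

text \<open>
  If \<open>\<delta>'L = L\<delta>\<close>, then \<open>q\<^sub>n \<cdot> L\<close> is an eigenfunction of \<open>\<delta>\<close> with the eigenvalue of \<open>p\<^sub>n\<close>. This replaces any
  computation with explicit formulas for the orthogonal polynomials.
\<close>

lemma (in hypergeometric_system) intertwinesI:
  assumes lin: "poly_linear L" and q: "\<And>n. hyper_op a' b' (q n) = smult (eig n) (q n)"
    and comm: "hyper_op a' b' \<odot> L = L \<odot> \<delta>"
  shows "intertwines L q p"
proof -
  have "\<delta> (L (q n)) = smult (eig n) (L (q n))" for n
    using fun_cong[OF comm, of "q n"] by (simp add: op_mult_def q poly_linear_smult[OF lin])
  then show ?thesis unfolding intertwines_def using eigenspace by blast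
qed

subsection \<open>Evaluation at a singular point\<close>

text \<open>
  A simple zero of the leading coefficient is a regular singular point of \<open>r \<cdot> \<delta> = \<lambda>r\<close>, with exponents
  \<open>0\<close> and \<open>1 - \<mu>\<close>. Since \<open>1 - \<mu>\<close> is not a positive integer, the solutions that are regular at \<open>x0\<close> are
  determined by their value there. In the classical cases \<open>\<mu> = \<alpha> + 1\<close> or \<open>\<mu> = \<beta> + 1\<close>.
\<close>

locale singular_point = hypergeometric_system +
  fixes x0 A \<mu> :: complex
  assumes root: "poly a x0 = 0" and slope: "poly (pderiv a) x0 = A" and A: "A \<noteq> 0"
    and b_at: "poly b x0 = A * \<mu>" and mu: "\<And>j. of_nat j + \<mu> \<noteq> 0"
begin

lemma pderiv2_a_const: "pderiv (pderiv a) = [:2 * coeff a 2:]"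
proof -
  have "degree (pderiv (pderiv a)) = 0" using degree_a by (simp add: degree_pderiv)
  then obtain c where "pderiv (pderiv a) = [:c:]" by (metis degree_eq_zeroE)
  moreover have "coeff (pderiv (pderiv a)) 0 = 2 * coeff a 2"
    by (simp add: coeff_pderiv numeral_2_eq_2)
  ultimately show ?thesis by simp
qed

lemma pderiv_b_const: "pderiv b = [:coeff b 1:]"
proof -
  have "degree (pderiv b) = 0" using degree_b by (simp add: degree_pderiv)
  then obtain c where "pderiv b = [:c:]" by (metis degree_eq_zeroE)
  moreover have "coeff (pderiv b) 0 = coeff b 1"
    by (simp add: coeff_pderiv)
  ultimately show ?thesis by simp
qed

text \<open>
  Leibniz' rule stops after the second derivative of \<open>a\<close> and the first derivative of \<open>b\<close>, and the
  constants that these contribute add up to the eigenvalue of index \<open>j\<close>.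
\<close>

lemma higher_pderiv_hyper_op:
  "(pderiv ^^ j) (\<delta> r) = (pderiv ^^ (j + 2)) r * a
     + (pderiv ^^ Suc j) r * (b + smult (of_nat j) (pderiv a))
     + smult (eig j) ((pderiv ^^ j) r)"
proof (induction j)
  case 0 show ?case by (simp add: hyper_op_def hyper_eigenvalue_def)
next
  case (Suc j)
  have e: "eig (Suc j) = eig j + 2 * of_nat j * coeff a 2 + coeff b 1"
    by (simp add: hyper_eigenvalue_def algebra_simps)
  show ?case
    by (simp add: Suc.IH e pderiv_add pderiv_mult pderiv_smult pderiv2_a_const pderiv_b_const algebra_simps
        smult_add_left smult_add_right)
qed

text \<open>
  At \<open>x0\<close> the term of highest order drops out, which turns the differential equation into a two-term
  recursion for the derivatives.
\<close>

lemma derivative_recursion: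
  assumes "\<delta> r = smult l r"
  shows "A * (of_nat j + \<mu>) * poly ((pderiv ^^ Suc j) r) x0 = (l - eig j) * poly ((pderiv ^^ j) r) x0"
proof -
  have "poly ((pderiv ^^ j) (\<delta> r)) x0 = l * poly ((pderiv ^^ j) r) x0"
    by (simp add: assms higher_pderiv_smult)
  then show ?thesis
    unfolding higher_pderiv_hyper_op by (simp add: root slope b_at algebra_simps)
qed

text \<open>
  Solving the recursion with initial value \<open>1\<close>: up to the factor \<open>j!\<close>, \<open>jet j\<close> evaluated at \<open>\<lambda>\<close> is the
  \<open>j\<close>-th Taylor coefficient at \<open>x0\<close> of the normalised hypergeometric series with parameter \<open>\<lambda>\<close>.
\<close>

fun jet :: "nat \<Rightarrow> complex poly" where
  "jet 0 = 1"
| "jet (Suc j) = smult (inverse (A * (of_nat j + \<mu>))) ([:- eig j, 1:] * jet j)"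

lemma derivative_at_singular_point:
  assumes "\<delta> r = smult l r"
  shows "poly ((pderiv ^^ j) r) x0 = poly (jet j) l * poly r x0"
proof (induction j)
  case (Suc j)
  have "A * (of_nat j + \<mu>) \<noteq> 0" using A mu by simp
  then show ?case using derivative_recursion[OF assms, of j] Suc.IH
    by (simp add: field_simps)
qed simp

text \<open>
  Otherwise all derivatives at \<open>x0\<close> would vanish, including the \<open>n\<close>-th one, which is \<open>n!\<close>.
\<close>

lemma p_at_nonzero: "poly (p n) x0 \<noteq> 0"
proof
  assume "poly (p n) x0 = 0"
  then have "poly ((pderiv ^^ n) (p n)) x0 = 0"
    using derivative_at_singular_point[OF eigen] by simp
  moreover have "degree ((pderiv ^^ n) (p n)) = 0" by (simp add: degree_higher_pderiv)
  moreover have "coeff ((pderiv ^^ n) (p n)) 0 \<noteq> 0"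
    by (simp add: coeff_higher_pderiv pochhammer_fact[symmetric])
  ultimately show False by (metis degree_eq_zeroE poly_pCons coeff_pCons_0 mult_zero_right poly_0 add.right_neutral)
qed

text \<open>
  The \<open>n\<close>-th derivative of \<open>p n\<close> is the constant \<open>n!\<close>. Reading the recursion backwards from it gives
  the value of \<open>p n\<close> at \<open>x0\<close>; the equation is stated without division.
\<close>

lemma p_at_singular_point:
  "poly (p n) x0 * (\<Prod>j<n. eig n - eig j) = fact n * A ^ n * pochhammer \<mu> n"
proof -
  have "poly (jet k) l * (A ^ k * pochhammer \<mu> k) = (\<Prod>j<k. l - eig j)" for k l
  proof (induction k)
    case (Suc k)
    define y where "y = A * (of_nat k + \<mu>)"
    have y: "y \<noteq> 0" using A mu by (simp add: y_def)
    have "A ^ Suc k * pochhammer \<mu> (Suc k) = y * (A ^ k * pochhammer \<mu> k)"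
      by (simp add: pochhammer_Suc y_def)
    moreover have "poly (jet (Suc k)) l = (l - eig k) * poly (jet k) l / y"
      by (simp add: y_def divide_inverse algebra_simps)
    ultimately have "poly (jet (Suc k)) l * (A ^ Suc k * pochhammer \<mu> (Suc k))
      = (l - eig k) * poly (jet k) l / y * (y * (A ^ k * pochhammer \<mu> k))"
      by (simp only:)
    also have "\<dots> = (l - eig k) * (poly (jet k) l * (A ^ k * pochhammer \<mu> k))"
      using y by simp
    finally have "poly (jet (Suc k)) l * (A ^ Suc k * pochhammer \<mu> (Suc k))
      = (l - eig k) * (poly (jet k) l * (A ^ k * pochhammer \<mu> k))" .
    then show ?case unfolding Suc.IH by (simp add: mult.commute)
  qed simp
  moreover have "poly ((pderiv ^^ n) (p n)) x0 = fact n"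
  proof -
    have "degree ((pderiv ^^ n) (p n)) = 0" by (simp add: degree_higher_pderiv)
    then obtain c where c: "(pderiv ^^ n) (p n) = [:c:]" by (metis degree_eq_zeroE)
    have "coeff ((pderiv ^^ n) (p n)) 0 = fact n"
      by (simp add: coeff_higher_pderiv pochhammer_fact[symmetric])
    with c show ?thesis by simp
  qed
  ultimately show ?thesis
    using derivative_at_singular_point[OF eigen, of n n] by (metis mult.assoc mult.commute)
qed

text \<open>
  Key fact: the value of \<open>p\<^sub>n \<cdot> L\<close> at \<open>x0\<close> is a combination of derivatives of \<open>p\<^sub>n\<close> at \<open>x0\<close>, all of which
  are \<open>p\<^sub>n(x0)\<close> times a polynomial in the eigenvalue that does not depend on \<open>n\<close>.
\<close>

lemma op_at_singular_point:
  assumes "L \<in> scalar_ops"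
  shows "\<exists>e. \<forall>n. poly (L (p n)) x0 = poly e (eig n) * poly (p n) x0"
proof -
  obtain m F where L: "L = (\<lambda>p. \<Sum>k\<le>m. (pderiv ^^ k) p * F k)"
    using assms by (rule scalar_opsE) blast
  have "poly (L (p n)) x0 = poly (\<Sum>k\<le>m. smult (poly (F k) x0) (jet k)) (eig n) * poly (p n) x0" for n
    by (simp add: L poly_sum derivative_at_singular_point[OF eigen] sum_distrib_right sum_distrib_left algebra_simps)
  then show ?thesis by blast
qed

end

section \<open>Rational ratios of Pochhammer symbols\<close>

definition shift_diff :: "complex poly \<Rightarrow> complex poly" where
  "shift_diff E = pcompose E [:1, 1:] - E"

text \<open>
  The difference \<open>E(x + 1) - E(x)\<close> has leading term \<open>m e x\<^sup>m\<^sup>-\<^sup>1\<close> if \<open>E\<close> has leading term \<open>e x\<^sup>m\<close>. The factor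
  \<open>x\<close> avoids the exponent \<open>m - 1\<close>, so that \<open>m = 0\<close> needs no separate treatment.
\<close>

lemma shift_diff_top:
  "degree E \<le> m \<Longrightarrow> degree ([:0, 1:] * shift_diff E) \<le> m \<and>
     coeff ([:0, 1:] * shift_diff E) m = of_nat m * coeff E m"
proof (induction E arbitrary: m)
  case 0 show ?case by (simp add: shift_diff_def)
next
  case (pCons c E)
  show ?case
  proof (cases "E = 0")
    case True
    then show ?thesis using pCons.prems by (cases m) (simp_all add: shift_diff_def)
  next
    case False
    then obtain k where m: "m = Suc k" "degree E \<le> k"
      using pCons.prems by (cases m) auto
    define D where "D = shift_diff E"
    have IH: "degree (pCons 0 D) \<le> k" "coeff (pCons 0 D) k = of_nat k * coeff E k"
      using pCons.IH[OF m(2)] by (simp_all add: D_def)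
    have eq: "[:0, 1:] * shift_diff (pCons c E) = pCons 0 (pCons 0 D + E + D)"
      by (simp add: shift_diff_def D_def pcompose_pCons algebra_simps)
    have D: "coeff D k = 0" using IH(1) by (metis coeff_pCons_Suc coeff_eq_0 le_imp_less_Suc)
    have dD: "degree D \<le> k" using IH(1) by (cases "D = 0") auto
    have "degree (pCons 0 D + E + D) \<le> k"
      by (intro degree_add_le IH m dD)
    then show ?thesis
      unfolding eq using IH(2) D
      by (auto simp: m(1) algebra_simps intro: order_trans[OF degree_pCons_le])
  qed
qed

lemma poly_eq_on_naturals:
  fixes P Q :: "complex poly"
  assumes "\<And>n. poly P (of_nat n) = poly Q (of_nat n)"
  shows "P = Q"
proof -
  have "infinite (range (of_nat :: nat \<Rightarrow> complex))"
    by (intro range_inj_infinite inj_of_nat)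
  moreover have "range (of_nat :: nat \<Rightarrow> complex) \<subseteq> {x. poly (P - Q) x = 0}"
    using assms by auto
  ultimately have "P - Q = 0" using poly_roots_finite finite_subset by blast
  then show ?thesis by simp
qed

text \<open>
  The quotient \<open>(\<alpha>)\<^sub>n(\<beta>)\<^sub>n / ((\<alpha>')\<^sub>n(\<beta>')\<^sub>n)\<close> grows like \<open>n\<close> to the power \<open>\<alpha> + \<beta> - \<alpha>' - \<beta>'\<close>; if it is the rational
  function \<open>C/E\<close>, that exponent is the difference of the degrees. The proof avoids asymptotics:
  dividing the equations for \<open>n + 1\<close> and \<open>n\<close> gives a polynomial identity whose leading terms
  cancel, and the next coefficient gives the claim.
\<close>

lemma pochhammer_ratio_rational:
  fixes E C :: "complex poly" and \<alpha> \<beta> \<alpha>' \<beta>' :: real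
  assumes pos: "\<alpha> > 0" "\<beta> > 0" "\<alpha>' > 0" "\<beta>' > 0"
    and eq: "\<And>n. poly E (of_nat n) * of_real (pochhammer \<alpha> n * pochhammer \<beta> n) =
               poly C (of_nat n) * of_real (pochhammer \<alpha>' n * pochhammer \<beta>' n)"
    and E: "E \<noteq> 0"
  shows "\<alpha> + \<beta> - \<alpha>' - \<beta>' = real (degree C) - real (degree E)"
proof -
  define X Y where "X n = complex_of_real (pochhammer \<alpha> n * pochhammer \<beta> n)"
    and "Y n = complex_of_real (pochhammer \<alpha>' n * pochhammer \<beta>' n)" for n
  have XY: "X n \<noteq> 0" "Y n \<noteq> 0" for n
    using pochhammer_pos[of \<alpha> n] pochhammer_pos[of \<beta> n] pochhammer_pos[of \<alpha>' n] pochhammer_pos[of \<beta>' n] pos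
    by (auto simp: X_def Y_def)
  have C: "C \<noteq> 0"
  proof
    assume "C = 0"
    then have "poly E (of_nat n) = poly 0 (of_nat n)" for n
      using eq[of n] XY by (simp add: X_def)
    then show False using poly_eq_on_naturals[of E 0] E by blast
  qed
  define G H where "G = [:of_real (\<alpha> * \<beta>), of_real (\<alpha> + \<beta>), 1::complex:]"
    and "H = [:of_real (\<alpha>' * \<beta>'), of_real (\<alpha>' + \<beta>'), 1::complex:]"
  \<comment> \<open>The Pochhammer symbols cancel in the quotient of two consecutive equations.\<close>
  have "pcompose E [:1, 1:] * C * G = pcompose C [:1, 1:] * E * H"
  proof (rule poly_eq_on_naturals)
    fix n
    let ?s = "of_nat n :: complex"
    have XS: "X (Suc n) = X n * poly G ?s" "Y (Suc n) = Y n * poly H ?s"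
      by (simp_all add: X_def Y_def G_def H_def pochhammer_Suc algebra_simps)
    have 0: "poly E ?s * X n = poly C ?s * Y n"
      using eq[of n] by (simp add: X_def Y_def)
    have 1: "poly E (1 + ?s) * (X n * poly G ?s) = poly C (1 + ?s) * (Y n * poly H ?s)"
      using eq[of "Suc n"] unfolding XS[symmetric] by (simp add: X_def Y_def)
    have "(X n * Y n) * (poly E (1 + ?s) * poly C ?s * poly G ?s)
        = (X n * Y n) * (poly C (1 + ?s) * poly E ?s * poly H ?s)"
      using 0 1 by algebra
    then show "poly (pcompose E [:1, 1:] * C * G) ?s = poly (pcompose C [:1, 1:] * E * H) ?s"
      using XY by (simp add: poly_pcompose)
  qed
  \<comment> \<open>Subtracting \<open>x E C G\<close> and \<open>x E C H\<close> removes the leading terms, so that only terms of degree at most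
    \<open>deg E + deg C + 2\<close> remain.\<close>
  moreover have "(x * (Es - E)) * (C * G) + E * (C * (x * (G - H))) - (x * (Cs - C)) * (E * H)
      = x * (Es * C * G - Cs * E * H)" for x Es Cs :: "complex poly"
    by algebra
  ultimately have "([:0, 1:] * shift_diff E) * (C * G) + E * (C * ([:0, 1:] * (G - H)))
           - ([:0, 1:] * shift_diff C) * (E * H) = 0"
    unfolding shift_diff_def by (metis right_minus_eq mult_zero_right)
  then have z: "coeff (([:0, 1:] * shift_diff E) * (C * G)) (degree E + (degree C + 2))
        + coeff (E * (C * ([:0, 1:] * (G - H)))) (degree E + (degree C + 2))
        - coeff (([:0, 1:] * shift_diff C) * (E * H)) (degree C + (degree E + 2)) = 0"
    by (metis (no_types, lifting) add.left_commute coeff_0 coeff_add coeff_diff)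
  note sd = conjunct1[OF shift_diff_top[OF order_refl]] conjunct2[OF shift_diff_top[OF order_refl]]
  have GH: "degree G \<le> 2" "degree H \<le> 2" "degree ([:0, 1:] * (G - H)) \<le> 2"
    "coeff G 2 = 1" "coeff H 2 = 1" "coeff ([:0, 1:] * (G - H)) 2 = of_real (\<alpha> + \<beta> - \<alpha>' - \<beta>')"
    by (auto simp: G_def H_def numeral_2_eq_2)
  have dCG: "degree (C * G) \<le> degree C + 2" "degree (E * H) \<le> degree E + 2"
    "degree (C * ([:0, 1:] * (G - H))) \<le> degree C + 2"
    by (rule order_trans[OF degree_mult_le], use GH in linarith)+
  have "of_nat (degree E) * lead_coeff E * lead_coeff C
        + lead_coeff E * lead_coeff C * of_real (\<alpha> + \<beta> - \<alpha>' - \<beta>')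
        - of_nat (degree C) * lead_coeff C * lead_coeff E = 0"
    using z
    by (simp only: coeff_mult_top[OF sd(1) dCG(1)] coeff_mult_top[OF order_refl dCG(3)]
         coeff_mult_top[OF sd(1) dCG(2)] coeff_mult_top[OF order_refl GH(1)]
         coeff_mult_top[OF order_refl GH(2)] coeff_mult_top[OF order_refl GH(3)] sd(2) GH)
       (simp add: mult_ac)
  then have "lead_coeff E * lead_coeff C *
      (of_nat (degree E) + of_real (\<alpha> + \<beta> - \<alpha>' - \<beta>') - of_nat (degree C)) = 0"
    by (simp add: algebra_simps)
  then have "complex_of_real (real (degree E) + (\<alpha> + \<beta> - \<alpha>' - \<beta>') - real (degree C)) = of_real 0"
    using E C by simp
  then show ?thesis unfolding of_real_eq_iff by linarith
qed

section \<open>Intertwining operators between hypergeometric systems\<close>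

locale hypergeometric_pair =
  src: hypergeometric_system a b p + tgt: hypergeometric_system a' b' q
  for a b p a' b' q
begin

lemma intertwiner_zeroI:
  assumes "L \<in> scalar_ops" "\<And>n. L (p n) = 0" shows "L = (\<lambda>_. 0)"
  using src.eq_on_p[OF scalar_ops_linear[OF assms(1)], of "\<lambda>_. 0"] assms(2)
  by (simp add: poly_linear_def)

text \<open>
  An intertwining operator does not raise degrees, so the leading coefficient of \<open>p\<^sub>n \<cdot> L\<close> depends only
  on the leading term \<open>x\<^sup>n\<close> of \<open>p\<^sub>n\<close>.
\<close>

lemma leading_coefficient_polynomial:
  assumes L: "L \<in> scalar_ops" and tw: "intertwines L p q"
  shows "\<exists>C. \<forall>n. L (p n) = smult (poly C (of_nat n)) (q n)"
proof -
  note lin = scalar_ops_linear[OF L]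
  obtain m F where LF: "L = (\<lambda>p. \<Sum>k\<le>m. (pderiv ^^ k) p * F k)"
    using L by (rule scalar_opsE) blast
  obtain C where C: "\<And>n. coeff (L (monom 1 n)) n = poly C (of_nat n)"
    using diagonal_coefficient_polynomial[OF LF] by blast
  obtain c where c: "\<And>n. L (p n) = smult (c n) (q n)"
    using tw unfolding intertwines_def by metis
  have "c n = poly C (of_nat n)" for n
  proof -
    have "\<exists>\<beta>. monom 1 n - p n = (\<Sum>k<n. smult (\<beta> k) (p k))"
    proof (rule src.expand)
      fix k assume "k \<ge> n"
      then show "coeff (monom 1 n - p n) k = 0"
        by (cases "k = n") (auto simp: coeff_eq_0)
    qed
    then obtain \<beta> where "monom 1 n - p n = (\<Sum>k<n. smult (\<beta> k) (p k))" by blast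
    then have "L (monom 1 n) = L (p n) + (\<Sum>k<n. smult (\<beta> k) (L (p k)))"
      by (metis (no_types, lifting) poly_linear_add[OF lin] poly_linear_sum[OF lin]
          poly_linear_smult[OF lin] diff_add_cancel add.commute sum.cong)
    then have "coeff (L (monom 1 n)) n = c n"
      by (simp add: c coeff_sum coeff_eq_0)
    with C show ?thesis by simp
  qed
  with c show ?thesis by auto
qed

end

locale isospectral_pair = hypergeometric_pair +
  assumes same_eigenvalues: "hyper_eigenvalue a b = hyper_eigenvalue a' b'"
begin

text \<open>
  The quotient is \<open>d = E(\<delta>')\<close>: both \<open>L\<close> and \<open>T \<cdot> d\<close> act on each \<open>p\<^sub>n\<close> in the same way. Here it matters that
  the two operators have the same eigenvalues.
\<close>

lemma factor_through:
  assumes T: "T \<in> scalar_ops" "intertwines T p q" and L: "L \<in> scalar_ops"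
    and E: "\<And>n. L (p n) = smult (poly E (src.eig n)) (T (p n))"
  shows "\<exists>d \<in> scalar_ops. intertwines d q q \<and> L = T \<odot> d"
proof
  define d where "d = op_poly E tgt.\<delta>"
  show d: "d \<in> scalar_ops" unfolding d_def by (intro scalar_ops_op_poly scalar_ops_hyper_op)
  have dq: "d (q n) = smult (poly E (src.eig n)) (q n)" for n
    unfolding d_def using op_poly_eigen[OF hyper_op_linear tgt.eigen] by (simp add: same_eigenvalues)
  have "L (p n) = (T \<odot> d) (p n)" for n
  proof -
    obtain t where "T (p n) = smult t (q n)" using T(2) by (auto simp: intertwines_def)
    then show ?thesis
      by (simp add: E op_mult_def dq poly_linear_smult[OF scalar_ops_linear[OF d]] mult.commute)
  qed
  then have "L = T \<odot> d"
    by (intro src.eq_on_p scalar_ops_linear L scalar_ops_compose T d)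
  with dq show "intertwines d q q \<and> L = T \<odot> d" unfolding intertwines_def by blast
qed

text \<open>
  If \<open>T\<close> multiplies values at \<open>x0\<close> by a constant, the multipliers of \<open>T\<close> are \<open>\<tau> p\<^sub>n(x0)/q\<^sub>n(x0)\<close> and those
  of \<open>L\<close> are \<open>e(\<lambda>\<^sub>n) p\<^sub>n(x0)/q\<^sub>n(x0)\<close>, so their quotient is polynomial in \<open>\<lambda>\<^sub>n\<close>.
\<close>

lemma factor_by_evaluation:
  assumes sing: "singular_point a b p x0 A \<mu>"
    and T: "T \<in> scalar_ops" "intertwines T p q" and \<tau>: "\<tau> \<noteq> 0" "\<And>r. poly (T r) x0 = \<tau> * poly r x0"
    and L: "L \<in> scalar_ops" "intertwines L p q"
  shows "\<exists>d \<in> scalar_ops. intertwines d q q \<and> L = T \<odot> d"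
proof -
  interpret singular_point a b p x0 A \<mu> by fact
  obtain e where e: "\<And>n. poly (L (p n)) x0 = poly e (src.eig n) * poly (p n) x0"
    using op_at_singular_point[OF L(1)] by blast
  show ?thesis
  proof (rule factor_through[OF T L(1)])
    fix n
    obtain t where t: "T (p n) = smult t (q n)" using T(2) by (auto simp: intertwines_def)
    obtain c where c: "L (p n) = smult c (q n)" using L(2) by (auto simp: intertwines_def)
    have 1: "t * poly (q n) x0 = \<tau> * poly (p n) x0" using \<tau>(2)[of "p n"] by (simp add: t)
    then have nz: "t \<noteq> 0" "poly (q n) x0 \<noteq> 0" using p_at_nonzero[of n] \<tau>(1) by auto
    have 2: "c * poly (q n) x0 = poly e (src.eig n) * poly (p n) x0" using e[of n] by (simp add: c)
    have "c = poly e (src.eig n) * t / \<tau>"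
    proof -
      have "poly (q n) x0 * (c * \<tau>) = poly (q n) x0 * (poly e (src.eig n) * t)"
        using 1 2 by algebra
      then show ?thesis using nz(2) \<tau>(1) by (simp add: field_simps)
    qed
    then show "L (p n) = smult (poly (smult (inverse \<tau>) e) (src.eig n)) (T (p n))"
      by (simp add: c t field_simps)
  qed
qed

text \<open>
  In the formula for the values at \<open>x0\<close>, everything except the Pochhammer symbol depends only on the
  spectrum and on \<open>A\<close>, and cancels.
\<close>

lemma singular_values:
  assumes "singular_point a b p x0 A \<mu>" "singular_point a' b' q x0 A \<mu>'"
  shows "poly (p n) x0 * pochhammer \<mu>' n = poly (q n) x0 * pochhammer \<mu> n"
proof -
  interpret s: singular_point a b p x0 A \<mu> by fact
  interpret t: singular_point a' b' q x0 A \<mu>' by fact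
  have nz: "(\<Prod>j<n. src.eig n - src.eig j) \<noteq> 0" "fact n * A ^ n \<noteq> (0::complex)"
    using src.inj_eigenvalue s.A by (auto simp: inj_eq)
  have "fact n * A ^ n * (poly (p n) x0 * pochhammer \<mu>' n) * (\<Prod>j<n. src.eig n - src.eig j)
     = fact n * A ^ n * (poly (q n) x0 * pochhammer \<mu> n) * (\<Prod>j<n. src.eig n - src.eig j)"
  proof -
    define P K where "P = (\<Prod>j<n. src.eig n - src.eig j)" and "K = fact n * A ^ n"
    have "poly (p n) x0 * P = K * pochhammer \<mu> n"
      "poly (q n) x0 * P = K * pochhammer \<mu>' n"
      using s.p_at_singular_point[of n] t.p_at_singular_point[of n]
      by (simp_all add: P_def K_def same_eigenvalues)
    then show ?thesis unfolding P_def[symmetric] K_def[symmetric] by algebra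
  qed
  then show ?thesis using nz by (simp only: mult_cancel_left mult_cancel_right) simp
qed

lemma multiplier_at_singular_point:
  assumes sing: "singular_point a b p x0 A \<mu>" "singular_point a' b' q x0 A \<mu>'"
    and L: "L \<in> scalar_ops" "\<And>n. L (p n) = smult (c n) (q n)"
  shows "\<exists>e. \<forall>n. poly e (src.eig n) * pochhammer \<mu> n = c n * pochhammer \<mu>' n"
proof -
  interpret s: singular_point a b p x0 A \<mu> by fact
  interpret t: singular_point a' b' q x0 A \<mu>' by fact
  obtain e where e: "\<And>n. poly (L (p n)) x0 = poly e (src.eig n) * poly (p n) x0"
    using s.op_at_singular_point[OF L(1)] by blast
  have "poly e (src.eig n) * pochhammer \<mu> n = c n * pochhammer \<mu>' n" for n
  proof -
    have "poly (q n) x0 * (poly e (src.eig n) * pochhammer \<mu> n) = poly (q n) x0 * (c n * pochhammer \<mu>' n)"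
      using e[of n] singular_values[OF sing, of n] unfolding L(2) poly_smult by algebra
    then show ?thesis using t.p_at_nonzero by simp
  qed
  then show ?thesis by blast
qed

end

text \<open>
  The first derivative of \<open>q\<^sub>n\<close> at \<open>x0\<close> is a constant multiple of \<open>\<lambda>'\<^sub>n q\<^sub>n(x0)\<close>. Comparing \<open>L\<close> and \<open>L\<partial>\<close> at \<open>x0\<close>
  therefore gives \<open>\<lambda>'\<^sub>n e(\<lambda>\<^sub>n) = h(\<lambda>\<^sub>n)\<close> up to a constant, that is, \<open>n e(\<lambda>\<^sub>n)\<close> is a polynomial in \<open>\<lambda>\<^sub>n\<close>. As \<open>\<lambda>\<^sub>n\<close> is
  quadratic in \<open>n\<close>, one side has odd degree and the other even degree unless \<open>e = 0\<close>.
\<close>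

lemma (in hypergeometric_pair) no_intertwiner_different_spectra:
  assumes sing: "singular_point a b p x0 A \<mu>" "singular_point a' b' q x0 A \<mu>'"
    and quad: "coeff a 2 \<noteq> 0" and \<kappa>: "\<kappa> \<noteq> 0" "\<And>n. tgt.eig n = src.eig n + \<kappa> * of_nat n"
    and L: "L \<in> scalar_ops" "intertwines L p q"
  shows "L = (\<lambda>_. 0)"
proof (rule intertwiner_zeroI[OF L(1)])
  interpret s: singular_point a b p x0 A \<mu> by fact
  interpret t: singular_point a' b' q x0 A \<mu>' by fact
  obtain e where e: "\<And>n. poly (L (p n)) x0 = poly e (src.eig n) * poly (p n) x0"
    using s.op_at_singular_point[OF L(1)] by blast
  obtain h where h: "\<And>n. poly (pderiv (L (p n))) x0 = poly h (src.eig n) * poly (p n) x0"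
    using s.op_at_singular_point[OF scalar_ops_pderiv[OF L(1)]] by blast
  obtain c where c: "\<And>n. L (p n) = smult (c n) (q n)"
    using L(2) unfolding intertwines_def by metis
  have "t.jet 1 = [:0, inverse (A * \<mu>'):]" by (simp add: hyper_eigenvalue_def)
  then have "poly (pderiv (q n)) x0 = tgt.eig n * inverse (A * \<mu>') * poly (q n) x0" for n
    using t.derivative_at_singular_point[OF tgt.eigen, of 1 n] by simp
  then have 1: "poly h (src.eig n) * poly (p n) x0 = tgt.eig n * inverse (A * \<mu>') * (poly e (src.eig n) * poly (p n) x0)" for n
    unfolding h[symmetric] e[symmetric] by (simp add: c pderiv_smult)
  have \<mu>': "A * \<mu>' \<noteq> 0" using t.A t.mu[of 0] by simp
  have 2: "\<kappa> * of_nat n * poly e (src.eig n) = (A * \<mu>' * poly h (src.eig n) - src.eig n * poly e (src.eig n))" for n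
  proof -
    define y where "y = A * \<mu>'"
    have "y * inverse y = 1" using \<mu>' by (intro right_inverse) (simp add: y_def)
    moreover have "poly h (src.eig n) * poly (p n) x0
        = tgt.eig n * inverse y * (poly e (src.eig n) * poly (p n) x0)"
      using 1[of n] by (simp add: y_def)
    ultimately have "poly (p n) x0 * (y * poly h (src.eig n)) = poly (p n) x0 * (tgt.eig n * poly e (src.eig n))"
      by algebra
    then have "y * poly h (src.eig n) = tgt.eig n * poly e (src.eig n)"
      using s.p_at_nonzero[of n] by simp
    then show ?thesis by (simp add: \<kappa>(2) y_def algebra_simps)
  qed
  define \<Lambda> where "\<Lambda> = [:0, coeff b 1 - coeff a 2, coeff a 2:]"
  have \<Lambda>: "src.eig n = poly \<Lambda> (of_nat n)" for n
    by (simp add: \<Lambda>_def hyper_eigenvalue_def algebra_simps)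
  have deg\<Lambda>: "degree \<Lambda> = 2" using quad by (simp add: \<Lambda>_def)
  define h' where "h' = smult (A * \<mu>') h - [:0, 1:] * e"
  have eq: "[:0, \<kappa>:] * pcompose e \<Lambda> = pcompose h' \<Lambda>"
    by (rule poly_eq_on_naturals)
       (use 2 in \<open>simp add: poly_pcompose \<Lambda>[symmetric] h'_def algebra_simps\<close>)
  have "e = 0"
  proof (rule ccontr)
    assume "e \<noteq> 0"
    then have "pcompose e \<Lambda> \<noteq> 0" using deg\<Lambda> by (simp add: pcompose_eq_0_iff)
    then have "degree ([:0, \<kappa>:] * pcompose e \<Lambda>) = 1 + 2 * degree e"
      using \<kappa>(1) by (subst degree_mult_eq) (auto simp: degree_pcompose deg\<Lambda>)
    then have "1 + 2 * degree e = 2 * degree h'"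
      unfolding eq by (simp add: degree_pcompose deg\<Lambda>)
    then show False by presburger
  qed
  then have "c n * poly (q n) x0 = 0" for n using e[of n] by (simp add: c)
  then show "L (p n) = 0" for n using c t.p_at_nonzero by simp
qed

section \<open>A translation is not a ratio of differential operators\<close>

lemma higher_pderiv_at_root:
  fixes g :: "complex poly"
  shows "j \<le> i \<Longrightarrow> poly ((pderiv ^^ j) ([:- z, 1:] ^ i * g)) z = (if j = i then fact i * poly g z else 0)"
proof (induction j arbitrary: i g)
  case 0 then show ?case by (auto simp: power_0_left)
next
  case (Suc j)
  then obtain k where k: "i = Suc k" "j \<le> k" by (cases i) auto
  have "pderiv ([:- z, 1:] ^ Suc k * g) = [:- z, 1:] ^ k * (smult (of_nat (Suc k)) g + [:- z, 1:] * pderiv g)"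
    unfolding pderiv_mult pderiv_power_Suc by (simp add: pderiv_pCons algebra_simps)
  then have "(pderiv ^^ Suc j) ([:- z, 1:] ^ i * g)
     = (pderiv ^^ j) ([:- z, 1:] ^ k * (smult (of_nat (Suc k)) g + [:- z, 1:] * pderiv g))"
    by (simp only: funpow_Suc_right o_apply k)
  then have "poly ((pderiv ^^ Suc j) ([:- z, 1:] ^ i * g)) z
     = (if j = k then fact k * poly (smult (of_nat (Suc k)) g + [:- z, 1:] * pderiv g) z else 0)"
    by (simp only: Suc.IH[OF k(2)])
  then show ?case by (simp add: k)
qed

text \<open>
  \<open>p \<cdot> L\<close> at a point \<open>y\<close> sees only the jet of \<open>p\<close> at \<open>y\<close>, while \<open>p \<cdot> Q\<close> at \<open>z = y + h\<close> sees only the jet at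
  \<open>z\<close>. A polynomial that vanishes to high order at \<open>y\<close> and has a prescribed order of vanishing at \<open>z\<close>
  separates them.
\<close>

lemma translation_not_differential:
  assumes Q: "Q \<in> scalar_ops" and L: "L \<in> scalar_ops" and h: "h \<noteq> 0"
    and eq: "\<And>p. L p = pcompose (Q p) [:h, 1:]"
  shows "Q = (\<lambda>_. 0)"
proof (rule ccontr)
  obtain m F where F: "L = (\<lambda>p. \<Sum>k\<le>m. (pderiv ^^ k) p * F k)" using L by (rule scalar_opsE) blast
  obtain M G where G: "Q = (\<lambda>p. \<Sum>k\<le>M. (pderiv ^^ k) p * G k)" "\<And>k. k > M \<Longrightarrow> G k = 0"
    using Q by (rule scalar_opsE) blast
  assume "Q \<noteq> (\<lambda>_. 0)"
  then have ex: "\<exists>k. G k \<noteq> 0" using G(1) by auto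
  define i where "i = (GREATEST k. G k \<noteq> 0)"
  have bound: "\<forall>k. G k \<noteq> 0 \<longrightarrow> k \<le> M" using G(2) not_le by blast
  have i: "G i \<noteq> 0" "\<And>k. k > i \<Longrightarrow> G k = 0"
  proof -
    show "G i \<noteq> 0"
      unfolding i_def by (rule GreatestI_ex_nat[where b = M]) (use ex bound in auto)
    show "G k = 0" if "k > i" for k
    proof (rule ccontr)
      assume "G k \<noteq> 0"
      then have "k \<le> i" unfolding i_def by (rule Greatest_le_nat[where b = M]) (use bound in auto)
      with that show False by simp
    qed
  qed
  obtain z where z: "poly (G i) z \<noteq> 0" using i(1) poly_all_0_iff_0 by blast
  \<comment> \<open>Vanishing order \<open>m + 1\<close> at \<open>z - h\<close> exceeds the order of \<open>L\<close>; vanishing order \<open>i\<close> at \<open>z\<close> isolates the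
    top coefficient of \<open>Q\<close>.\<close>
  define r where "r = [:- (z - h), 1:] ^ Suc m * [:- z, 1:] ^ i"
  have "poly ((pderiv ^^ k) r) (z - h) = 0" if "k \<le> m" for k
    unfolding r_def using that by (subst higher_pderiv_at_root) auto
  then have "poly (L r) (z - h) = 0" by (simp add: F poly_sum)
  then have 0: "poly (Q r) z = 0" by (simp add: eq poly_pcompose)
  have "poly ((pderiv ^^ k) r * G k) z = (if k = i then fact i * h ^ Suc m * poly (G i) z else 0)" for k
  proof (cases "k \<le> i")
    case True
    have "r = [:- z, 1:] ^ i * [:- (z - h), 1:] ^ Suc m" by (simp only: r_def mult.commute)
    moreover have "poly ([:- (z - h), 1:] ^ Suc m) z = h ^ Suc m"
      unfolding poly_power by simp
    ultimately show ?thesis using higher_pderiv_at_root[OF True, of z "[:- (z - h), 1:] ^ Suc m"]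
      by (simp only: poly_mult) simp
  next
    case False then show ?thesis using i(2) by simp
  qed
  moreover have "i \<le> M" using bound i(1) by blast
  ultimately have "poly (Q r) z = fact i * h ^ Suc m * poly (G i) z"
    by (simp add: G(1) poly_sum del: poly_mult)
  with 0 z h show False by simp
qed

section \<open>Weights with finite moments and their orthogonal polynomials\<close>

text \<open>
  The complex conjugate of a polynomial on the real line is again a polynomial; thus the sesquilinear
  form becomes a linear functional of \<open>p \<cdot> conj_poly q\<close>.
\<close>

definition conj_poly :: "complex poly \<Rightarrow> complex poly" where
  "conj_poly = map_poly cnj"

lemma coeff_conj_poly [simp]: "coeff (conj_poly p) n = cnj (coeff p n)"
  by (simp add: conj_poly_def coeff_map_poly)

lemma conj_poly_simps [simp]:
  "conj_poly 0 = 0" "conj_poly (p + q) = conj_poly p + conj_poly q"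
  "conj_poly (- p) = - conj_poly p"
  "conj_poly (p - q) = conj_poly p - conj_poly q"
  "conj_poly (smult c p) = smult (cnj c) (conj_poly p)"
  "conj_poly (conj_poly p) = p" "conj_poly (pderiv p) = pderiv (conj_poly p)"
  by (auto intro!: poly_eqI simp: coeff_pderiv)

lemma conj_poly_mult [simp]: "conj_poly (p * q) = conj_poly p * conj_poly q"
  by (rule poly_eqI) (simp add: coeff_mult)

lemma poly_conj_poly [simp]: "poly (conj_poly p) (of_real x) = cnj (poly p (of_real x))"
  by (induction p) (simp_all add: conj_poly_def map_poly_pCons)

lemma is_scalar_mopsD:
  assumes "is_scalar_mops w P"
  shows "degree (P n) = n" "lead_coeff (P n) = 1" "n \<noteq> m \<Longrightarrow> scalar_inner w (P n) (P m) = 0"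
  using assms unfolding is_scalar_mops_def by blast+

locale moment_weight =
  fixes w :: "real \<Rightarrow> real"
  assumes integrable_moment [simp]:
      "integrable lborel (\<lambda>x. poly p (complex_of_real x) * complex_of_real (w x))"
    and weight_nonneg: "w x \<ge> 0"
    and weight_pos: "\<exists>s t. s < t \<and> (\<forall>x. s < x \<and> x < t \<longrightarrow> w x > 0)"
begin

definition functional :: "complex poly \<Rightarrow> complex" where
  "functional p = (\<integral>x. poly p (complex_of_real x) * complex_of_real (w x) \<partial>lborel)"

lemma functional_add: "functional (p + q) = functional p + functional q"
  by (simp add: functional_def distrib_right)

lemma functional_smult: "functional (smult c p) = c * functional p"
  by (simp add: functional_def mult.assoc)

abbreviation "ip \<equiv> scalar_inner w"

lemma inner_eq: "ip p q = functional (p * conj_poly q)"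
  unfolding scalar_inner_def functional_def by (intro Bochner_Integration.integral_cong) (simp_all add: mult_ac)

lemma inner_integrable:
  "integrable lborel (\<lambda>x. poly p (complex_of_real x) * complex_of_real (w x) * cnj (poly q (complex_of_real x)))"
  using integrable_moment[of "p * conj_poly q"] by (simp add: mult_ac)

lemma functional_conj: "functional (conj_poly p) = cnj (functional p)"
proof -
  have "cnj (functional p) = (\<integral>x. cnj (poly p (complex_of_real x) * complex_of_real (w x)) \<partial>lborel)"
    unfolding functional_def by (rule Bochner_Integration.integral_cnj[symmetric])
  then show ?thesis by (simp add: functional_def)
qed

lemma inner_hermitian: "ip q p = cnj (ip p q)"
  by (simp add: inner_eq functional_conj[symmetric] mult.commute)

lemma inner_add_left: "ip (p + p') q = ip p q + ip p' q"
  and inner_smult_left: "ip (smult c p) q = c * ip p q"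
  and inner_smult_right: "ip p (smult c q) = cnj c * ip p q"
  by (simp_all add: inner_eq functional_add functional_smult distrib_right)

lemma inner_0_left [simp]: "ip 0 q = 0"
  using inner_smult_left[of 0 0 q] by simp

lemma inner_diff_left: "ip (p - p') q = ip p q - ip p' q"
  using inner_add_left[of "p - p'" p' q] by simp

lemma inner_0_right [simp]: "ip p 0 = 0"
  using inner_smult_right[of p 0 0] by simp

lemma inner_add_right: "ip p (q + q') = ip p q + ip p q'"
  by (simp add: inner_eq functional_add distrib_left)

lemma inner_sum_left: "ip (sum f A) q = (\<Sum>x\<in>A. ip (f x) q)"
  by (induction A rule: infinite_finite_induct) (simp_all add: inner_add_left)

lemma inner_sum_right: "ip p (sum f A) = (\<Sum>x\<in>A. ip p (f x))"
  by (induction A rule: infinite_finite_induct) (simp_all add: inner_add_right)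

text \<open>
  A nonzero polynomial has finitely many zeros, so \<open>\<bar>p\<bar>\<^sup>2w\<close> is positive almost everywhere on an interval
  on which \<open>w\<close> is positive.
\<close>

lemma inner_definite:
  assumes "ip p p = 0" shows "p = 0"
proof (rule ccontr)
  assume "p \<noteq> 0"
  define g where "g x = (cmod (poly p (complex_of_real x)))\<^sup>2 * w x" for x
  have eq: "poly (p * conj_poly p) (complex_of_real x) * complex_of_real (w x) = of_real (g x)" for x
    by (simp add: g_def complex_norm_square[symmetric] del: of_real_power)
  have int: "integrable lborel g"
    using integrable_moment[of "p * conj_poly p"] unfolding eq by (simp add: complex_of_real_integrable_eq)
  have "complex_of_real (\<integral>x. g x \<partial>lborel) = 0"
    using assms unfolding inner_eq functional_def eq by (simp add: integral_complex_of_real)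
  then have "(\<integral>x. g x \<partial>lborel) = 0" by simp
  moreover have "AE x in lborel. 0 \<le> g x" by (simp add: g_def weight_nonneg)
  ultimately have "AE x in lborel. g x = 0"
    using integral_nonneg_eq_0_iff_AE[OF int] by simp
  moreover have "AE x in lborel. x \<notin> {x. poly p (complex_of_real x) = 0}"
  proof (intro AE_not_in finite_imp_null_set_lborel)
    have "finite (complex_of_real -` {z. poly p z = 0})"
      by (intro finite_vimageI poly_roots_finite \<open>p \<noteq> 0\<close>) (simp add: inj_of_real)
    then show "finite {x. poly p (complex_of_real x) = 0}" by (simp add: vimage_def)
  qed
  ultimately have "AE x in lborel. w x = 0"
    by eventually_elim (auto simp: g_def)
  then have w0: "AE x in lborel. w x = 0" .
  obtain s t where st: "s < t" "\<And>x. s < x \<Longrightarrow> x < t \<Longrightarrow> w x > 0"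
    using weight_pos by blast
  have "AE x in lborel. x \<notin> {s<..<t}"
    using w0 by eventually_elim (use st(2) in force)
  then have "{s<..<t} \<in> null_sets lborel"
    by (subst AE_iff_null_sets) auto
  then show False using st(1) by (simp add: null_sets_def)
qed

lemma inner_nonzero: "p \<noteq> 0 \<Longrightarrow> ip p p \<noteq> 0"
  using inner_definite by blast

subsection \<open>Existence and uniqueness of the monic orthogonal sequence\<close>

text \<open>
  One step of the Gram-Schmidt process, by strong induction on the degree. Orthogonality is required
  against all polynomials of smaller degree, written as a condition on coefficients so that \<open>n = 0\<close> and
  the zero polynomial are included.
\<close>

lemma orthogonal_exists:
  "\<exists>p. degree p = n \<and> lead_coeff p = 1 \<and> (\<forall>q. (\<forall>k\<ge>n. coeff q k = 0) \<longrightarrow> ip p q = 0)"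
proof (induction n rule: less_induct)
  case (less n)
  then obtain P where P: "\<And>m. m < n \<Longrightarrow> degree (P m) = m \<and> lead_coeff (P m) = 1 \<and>
      (\<forall>q. (\<forall>k\<ge>m. coeff q k = 0) \<longrightarrow> ip (P m) q = 0)"
    by metis
  \<comment> \<open>The expansion in a monic sequence needs a member in every degree, so the finite sequence is
    completed by monomials.\<close>
  define Q where "Q m = (if m < n then P m else monom 1 m)" for m
  have Q: "degree (Q m) = m" "lead_coeff (Q m) = 1" for m
    using P[of m] by (cases "m < n"; simp add: Q_def degree_monom_eq; metis)+
  have orth: "ip (P i) (P j) = 0" if "i < n" "j < n" "i \<noteq> j" for i j
  proof -
    have *: "ip (P i) (P j) = 0" if "j < i" "i < n" for i j
      using P[of i] P[of j] that by (auto simp: coeff_eq_0)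
    show ?thesis
    proof (cases "j < i")
      case False
      then have "ip (P j) (P i) = 0" using * that by simp
      then show ?thesis by (subst inner_hermitian) simp
    qed (use * that in auto)
  qed
  have nz: "ip (P m) (P m) \<noteq> 0" if "m < n" for m
    using P[OF that] inner_nonzero[of "P m"] by force
  define p where "p = monom 1 n - (\<Sum>m<n. smult (ip (monom 1 n) (P m) / ip (P m) (P m)) (P m))"
  have c: "coeff p k = (if k = n then 1 else 0)" if "k \<ge> n" for k
    using P that by (auto simp: p_def coeff_sum intro!: sum.neutral coeff_eq_0)
  have "degree p = n"
    by (rule antisym[OF degree_le le_degree]) (use c in auto)
  moreover have "ip p q = 0" if q: "\<forall>k\<ge>n. coeff q k = 0" for q
  proof -
    have 0: "ip p (P k) = 0" if "k < n" for k
    proof -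
      have "ip p (P k) = ip (monom 1 n) (P k)
          - (\<Sum>m<n. ip (monom 1 n) (P m) / ip (P m) (P m) * ip (P m) (P k))"
        by (simp add: p_def inner_diff_left inner_sum_left inner_smult_left)
      also have "(\<Sum>m<n. ip (monom 1 n) (P m) / ip (P m) (P m) * ip (P m) (P k))
        = (\<Sum>m\<in>{k}. ip (monom 1 n) (P m) / ip (P m) (P m) * ip (P m) (P k))"
        using that orth by (intro sum.mono_neutral_right) auto
      finally show ?thesis using nz[OF that] by simp
    qed
    obtain b where "q = (\<Sum>k<n. smult (b k) (Q k))"
      using monic_sequence_expand[of Q n q] Q q by blast
    then show ?thesis using 0 by (simp add: inner_sum_right inner_smult_right Q_def)
  qed
  ultimately show ?case using c[of n] by auto
qed

lemma mops_orthogonal_lower: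
  assumes P: "is_scalar_mops w P" and q: "\<And>k. k \<ge> n \<Longrightarrow> coeff q k = 0"
  shows "ip (P n) q = 0"
proof -
  obtain b where "q = (\<Sum>k<n. smult (b k) (P k))"
    using monic_sequence_expand[of P n q, OF is_scalar_mopsD(1,2)[OF P] q] by blast
  then show ?thesis using P by (simp add: inner_sum_right inner_smult_right is_scalar_mops_def)
qed

text \<open>
  Both uniqueness statements, for scalar and for diagonal matrix weights, and the eigenvalue equation
  are instances of this principle.
\<close>

lemma orthogonal_to_mops_zero:
  assumes P: "is_scalar_mops w P" and q: "\<And>k. k \<ge> n \<Longrightarrow> coeff q k = 0"
    and orth: "\<And>m. m < n \<Longrightarrow> ip q (P m) = 0"
  shows "q = 0"
proof -
  obtain b where b: "q = (\<Sum>k<n. smult (b k) (P k))"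
    using monic_sequence_expand[of P n q, OF is_scalar_mopsD(1,2)[OF P] q] by blast
  have "ip q q = (\<Sum>k<n. cnj (b k) * ip q (P k))"
    by (subst (2) b) (simp add: inner_sum_right inner_smult_right)
  then show ?thesis using orth inner_definite by simp
qed

lemma mops_unique:
  assumes P: "is_scalar_mops w P" and Q: "is_scalar_mops w Q"
  shows "P = Q"
proof
  fix n
  have "P n - Q n = 0"
  proof (rule orthogonal_to_mops_zero[OF P])
    fix k assume "n \<le> k"
    then show "coeff (P n - Q n) k = 0"
      using P Q by (cases "k = n") (auto simp: is_scalar_mops_def coeff_eq_0 dest!: spec[of _ n])
  next
    fix m assume "m < n"
    moreover have "degree (P m) = m" using P by (simp add: is_scalar_mops_def)
    ultimately show "ip (P n - Q n) (P m) = 0"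
      using mops_orthogonal_lower[OF P, of n "P m"] mops_orthogonal_lower[OF Q, of n "P m"]
      by (simp add: inner_diff_left coeff_eq_0)
  qed
  then show "P n = Q n" by simp
qed

lemma scalar_mops: "is_scalar_mops w (scalar_mops w)"
proof -
  obtain P where P: "\<And>n. degree (P n) = n \<and> lead_coeff (P n) = 1 \<and>
      (\<forall>q. (\<forall>k\<ge>n. coeff q k = 0) \<longrightarrow> ip (P n) q = 0)"
    using orthogonal_exists by metis
  have lower: "ip (P n) (P m) = 0" if "m < n" for m n
    using P[of n] P[of m] that by (auto simp: coeff_eq_0)
  have "ip (P n) (P m) = 0" if "n \<noteq> m" for m n
    using that lower[of m n] lower[of n m] inner_hermitian[of "P n" "P m"]
    by (cases "m < n") auto
  with P have "is_scalar_mops w P" unfolding is_scalar_mops_def by blast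
  then show ?thesis
    unfolding scalar_mops_def using mops_unique by (metis theI)
qed

lemma degree_mops: "degree (scalar_mops w n) = n"
  and lead_mops: "lead_coeff (scalar_mops w n) = 1"
  by (rule is_scalar_mopsD[OF scalar_mops])+

end

subsection \<open>The Pearson equation\<close>

text \<open>
  The Pearson equation \<open>(aw)' = bw\<close> in integrated form: the integral of \<open>(g a w)'\<close> vanishes for all
  polynomials \<open>g\<close>.
\<close>

locale pearson_weight = moment_weight +
  fixes a b :: "complex poly"
  assumes deg_a: "degree a \<le> 2" and deg_b: "degree b \<le> 1"
    and real_a: "conj_poly a = a"
    and inj_ev: "inj (hyper_eigenvalue a b)"
    and pearson: "functional (pderiv g * a + g * b) = 0"
begin

text \<open>
  Integration by parts; the right-hand side is visibly symmetric in \<open>p\<close> and the conjugate of \<open>q\<close>.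
\<close>

lemma hyper_op_weak:
  "ip (hyper_op a b p) q = - functional (pderiv p * pderiv (conj_poly q) * a)"
proof -
  have "functional (pderiv (pderiv p * conj_poly q) * a + pderiv p * conj_poly q * b) = 0"
    by (rule pearson)
  moreover have "pderiv (pderiv p * conj_poly q) * a + pderiv p * conj_poly q * b
      = hyper_op a b p * conj_poly q + pderiv p * pderiv (conj_poly q) * a"
    by (simp add: hyper_op_def pderiv_mult algebra_simps)
  ultimately show ?thesis by (simp add: inner_eq functional_add add_eq_0_iff)
qed

lemma hyper_op_symmetric: "ip (hyper_op a b p) q = ip p (hyper_op a b q)"
proof -
  have "ip p (hyper_op a b q) = cnj (ip (hyper_op a b q) p)" by (rule inner_hermitian)
  also have "\<dots> = - functional (conj_poly (pderiv q * pderiv (conj_poly p) * a))"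
    by (simp only: hyper_op_weak functional_conj complex_cnj_minus)
  finally show ?thesis by (simp add: hyper_op_weak real_a mult_ac)
qed

text \<open>
  By symmetry, \<open>p\<^sub>n \<cdot> \<delta>\<close> is orthogonal to all polynomials of smaller degree, and its leading coefficient is
  \<open>\<lambda>\<^sub>n\<close>.
\<close>

lemma mops_eigen:
  "hyper_op a b (scalar_mops w n) = smult (hyper_eigenvalue a b n) (scalar_mops w n)"
proof -
  let ?P = "scalar_mops w"
  have top: "coeff (hyper_op a b r) k = hyper_eigenvalue a b k * coeff r k" if "degree r \<le> k" for r k
    by (rule coeff_hyper_op_top[OF deg_a deg_b that])
  have "hyper_op a b (?P n) - smult (hyper_eigenvalue a b n) (?P n) = 0"
  proof (rule orthogonal_to_mops_zero[OF scalar_mops])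
    fix k assume "n \<le> k"
    then show "coeff (hyper_op a b (?P n) - smult (hyper_eigenvalue a b n) (?P n)) k = 0"
      using top[of "?P n" k] by (cases "k = n") (auto simp: degree_mops coeff_eq_0)
  next
    fix m assume m: "m < n"
    have "ip (?P n) (hyper_op a b (?P m)) = 0"
      by (rule mops_orthogonal_lower[OF scalar_mops])
         (use m top in \<open>simp add: degree_mops coeff_eq_0\<close>)
    moreover have "ip (?P n) (?P m) = 0"
      using m scalar_mops by (simp add: is_scalar_mops_def)
    ultimately show "ip (hyper_op a b (?P n) - smult (hyper_eigenvalue a b n) (?P n)) (?P m) = 0"
      by (simp add: inner_diff_left inner_smult_left hyper_op_symmetric)
  qed
  then show ?thesis by simp
qed

lemma hypergeometric: "hypergeometric_system a b (scalar_mops w)"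
  by unfold_locales (use deg_a deg_b inj_ev degree_mops lead_mops mops_eigen in auto)

end

section \<open>The classical weights\<close>

lemma integrable_poly_weight:
  fixes w :: "real \<Rightarrow> real"
  assumes "\<And>k. integrable lborel (\<lambda>x. x ^ k * w x)"
  shows "integrable lborel (\<lambda>x. poly p (complex_of_real x) * complex_of_real (w x))"
proof -
  have "integrable lborel (\<lambda>x. \<Sum>k\<le>degree p. coeff p k * complex_of_real (x ^ k * w x))"
    by (intro Bochner_Integration.integrable_sum integrable_mult_right integrable_of_real assms)
  also have "(\<lambda>x. \<Sum>k\<le>degree p. coeff p k * complex_of_real (x ^ k * w x))
      = (\<lambda>x. poly p (complex_of_real x) * complex_of_real (w x))"
    by (simp add: poly_altdef sum_distrib_right mult.assoc)
  finally show ?thesis .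
qed

lemma poly_weight_tendsto_0:
  fixes r v :: "'a \<Rightarrow> real"
  assumes "\<And>k. ((\<lambda>y. r y ^ k * v y) \<longlongrightarrow> 0) F"
  shows "((\<lambda>y. poly p (complex_of_real (r y)) * complex_of_real (v y)) \<longlongrightarrow> 0) F"
proof -
  have "((\<lambda>y. \<Sum>k\<le>degree p. coeff p k * complex_of_real (r y ^ k * v y)) \<longlongrightarrow>
      (\<Sum>k\<le>degree p. coeff p k * of_real 0)) F"
    by (intro tendsto_sum tendsto_mult tendsto_const tendsto_of_real assms)
  then show ?thesis by (simp add: poly_altdef sum_distrib_right mult.assoc)
qed

text \<open>
  The fundamental theorem of calculus applied to \<open>g a w\<close> on the open, possibly infinite interval of
  support; the boundary terms vanish because all \<open>x\<^sup>k a w\<close> tend to \<open>0\<close> at both ends.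
\<close>

lemma pearson_equation:
  fixes w A B :: "real \<Rightarrow> real" and l u :: ereal
  assumes lu: "l < u" and supp: "\<And>x. x \<notin> einterval l u \<Longrightarrow> w x = 0"
    and int: "\<And>k. integrable lborel (\<lambda>x. x ^ k * w x)"
    and ab: "\<And>x. poly a (complex_of_real x) = of_real (A x)" "\<And>x. poly b (complex_of_real x) = of_real (B x)"
    and deriv: "\<And>x. x \<in> einterval l u \<Longrightarrow> ((\<lambda>x. A x * w x) has_real_derivative B x * w x) (at x)"
    and cont: "\<And>x. x \<in> einterval l u \<Longrightarrow> isCont w x"
    and lim: "\<And>k. (((\<lambda>x. x ^ k * (A x * w x)) \<circ> real_of_ereal) \<longlongrightarrow> 0) (at_right l)"
      "\<And>k. (((\<lambda>x. x ^ k * (A x * w x)) \<circ> real_of_ereal) \<longlongrightarrow> 0) (at_left u)"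
  shows "(\<integral>x. poly (pderiv g * a + g * b) (complex_of_real x) * complex_of_real (w x) \<partial>lborel) = 0"
proof -
  define f where "f x = poly (pderiv g * a + g * b) (complex_of_real x) * complex_of_real (w x)" for x
  define F where "F x = poly g (complex_of_real x) * complex_of_real (A x * w x)" for x
  have f: "integrable lborel f" unfolding f_def by (intro integrable_poly_weight int)
  have ind: "indicator (einterval l u) x *\<^sub>R f x = f x" for x
    using supp[of x] by (auto simp: f_def indicator_def)
  have "(LBINT x=l..u. f x) = 0 - 0"
  proof (rule interval_integral_FTC_integrable[where F = F])
    fix x :: real assume "l < ereal x" "ereal x < u"
    then have x: "x \<in> einterval l u" by (simp add: einterval_def)
    have "((\<lambda>x. poly g (complex_of_real x)) has_vector_derivative poly (pderiv g) (complex_of_real x)) (at x)"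
      by (rule has_vector_derivative_real_field) (rule poly_DERIV)
    moreover have "((\<lambda>x. complex_of_real (A x * w x)) has_vector_derivative of_real (B x * w x)) (at x)"
      using deriv[OF x] by (intro has_vector_derivative_of_real) (simp add: has_real_derivative_iff_has_vector_derivative)
    ultimately have "(F has_vector_derivative (poly g (complex_of_real x) * of_real (B x * w x)
        + poly (pderiv g) (complex_of_real x) * complex_of_real (A x * w x))) (at x)"
      unfolding F_def by (rule has_vector_derivative_mult)
    then show "(F has_vector_derivative f x) (at x)"
      by (simp add: f_def ab algebra_simps)
    show "isCont f x"
      unfolding f_def using cont[OF x] by (intro continuous_intros)
  next
    show "set_integrable lborel (einterval l u) f" unfolding set_integrable_def ind by (rule f)
    show "((F \<circ> real_of_ereal) \<longlongrightarrow> 0) (at_right l)" "((F \<circ> real_of_ereal) \<longlongrightarrow> 0) (at_left u)"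
      using lim unfolding F_def o_def by (intro poly_weight_tendsto_0; simp)+
  qed (use lu in auto)
  then have "(\<integral>x. f x \<partial>lborel) = 0"
    using lu less_imp_le[OF lu] unfolding interval_lebesgue_integral_def set_lebesgue_integral_def ind
    by simp
  then show ?thesis unfolding f_def .
qed

lemma laguerre_integrable:
  assumes "a > -1"
  shows "integrable lborel (\<lambda>x. x ^ k * weight (Laguerre a) x)"
proof -
  have "(\<lambda>t. complex_of_real t powr (complex_of_real (a + k + 1) - 1) / of_real (exp t)) absolutely_integrable_on {0<..}"
    using assms by (intro absolutely_integrable_Gamma_integral') simp
  then have "integrable lebesgue (\<lambda>t. Re (indicator {0<..} t *\<^sub>R (complex_of_real t powr (complex_of_real (a + k + 1) - 1) / of_real (exp t))))"
    unfolding set_integrable_def by (rule integrable_Re)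
  also have "(\<lambda>t. Re (indicator {0<..} t *\<^sub>R (complex_of_real t powr (complex_of_real (a + k + 1) - 1) / of_real (exp t))))
     = (\<lambda>x. x ^ k * weight (Laguerre a) x)"
  proof
    fix t :: real
    have "complex_of_real t powr (complex_of_real (a + k + 1) - 1) = of_real (t powr (a + k))" if "t > 0"
      using that powr_of_real[of t "a + k"] by simp
    then show "Re (indicator {0<..} t *\<^sub>R (complex_of_real t powr (complex_of_real (a + k + 1) - 1) / of_real (exp t)))
      = t ^ k * weight (Laguerre a) t"
      by (cases "t > 0") (simp_all add: exp_minus field_simps powr_add powr_realpow)
  qed
  finally show ?thesis by (subst (asm) integrable_completion) auto
qed

text \<open>
  The substitution \<open>t = (1 + x)/2\<close> reduces the weight to the integrand of the Beta function, and \<open>x\<^sup>k\<close> is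
  bounded by \<open>1\<close> on the support.
\<close>

lemma jacobi_integrable:
  assumes "a > -1" "b > -1"
  shows "integrable lborel (\<lambda>x. x ^ k * weight (Jacobi a b) x)"
proof -
  define f where "f t = indicator {0..1} t *\<^sub>R (t powr (b + 1 - 1) * (1 - t) powr (a + 1 - 1))" for t :: real
  have "integrable lborel f"
    using integrable_Beta[of "b + 1" "a + 1"] assms unfolding set_integrable_def f_def by simp
  then have "integrable lborel (\<lambda>x. f (1/2 + 1/2 * x))"
    by (rule lborel_integrable_real_affine) simp
  then have "integrable lborel (\<lambda>x. 2 powr (a + b) * f (1/2 + 1/2 * x))" by simp
  then show ?thesis
  proof (rule Bochner_Integration.integrable_bound)
    show "(\<lambda>x. x ^ k * weight (Jacobi a b) x) \<in> borel_measurable lborel"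
      by simp
    show "AE x in lborel. norm (x ^ k * weight (Jacobi a b) x) \<le> norm (2 powr (a + b) * f (1/2 + 1/2 * x))"
    proof (rule AE_I2)
      fix x :: real
      show "norm (x ^ k * weight (Jacobi a b) x) \<le> norm (2 powr (a + b) * f (1/2 + 1/2 * x))"
      proof (cases "-1 < x \<and> x < 1")
        case True
        then have 1: "\<bar>x\<bar> ^ k \<le> 1" by (intro power_le_one) auto
        have "(1 + x) powr b = 2 powr b * ((1 + x) / 2) powr b" "(1 - x) powr a = 2 powr a * ((1 - x) / 2) powr a"
          using True by (simp_all add: powr_divide)
        moreover have "f (1/2 + 1/2 * x) = ((1 + x) / 2) powr b * ((1 - x) / 2) powr a"
          using True by (simp add: f_def add_divide_distrib diff_divide_distrib)
        ultimately have "2 powr (a + b) * f (1/2 + 1/2 * x) = weight (Jacobi a b) x"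
          using True by (simp add: powr_add)
        moreover have "\<bar>x\<bar> ^ k * weight (Jacobi a b) x \<le> 1 * weight (Jacobi a b) x"
          using 1 by (intro mult_right_mono) auto
        ultimately show ?thesis using True by (simp add: abs_mult power_abs)
      next
        case False
        then have "weight (Jacobi a b) x = 0" by auto
        then show ?thesis by simp
      qed
    qed
  qed
qed

text \<open>
  Up to a constant, the weight is the Gaussian density with mean \<open>b\<close> and variance \<open>1/2\<close>, whose central
  moments are finite.
\<close>

lemma hermite_integrable: "integrable lborel (\<lambda>x. x ^ k * weight (Hermite b) x)"
proof -
  have "integrable lborel (\<lambda>x. poly (pcompose (monom 1 k) [:b, 1:]) (x - b) * (normal_density b (1 / sqrt 2) x))"
  proof -
    define q where "q = pcompose (monom (1::real) k) [:b, 1:]"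
    have "integrable lborel (\<lambda>x. \<Sum>i\<le>degree q. coeff q i * (normal_density b (1 / sqrt 2) x * (x - b) ^ i))"
      by (intro Bochner_Integration.integrable_sum integrable_mult_right integrable_normal_moment) simp
    then show ?thesis unfolding q_def[symmetric] by (simp add: poly_altdef sum_distrib_left mult_ac)
  qed
  then have "integrable lborel (\<lambda>x. (exp (b\<^sup>2) * sqrt pi) * (x ^ k * normal_density b (1 / sqrt 2) x))"
    by (intro integrable_mult_right) (simp add: poly_pcompose poly_monom)
  also have "(\<lambda>x. (exp (b\<^sup>2) * sqrt pi) * (x ^ k * normal_density b (1 / sqrt 2) x)) = (\<lambda>x. x ^ k * weight (Hermite b) x)"
  proof
    fix x
    have "normal_density b (1 / sqrt 2) x = exp (- (x - b)\<^sup>2) / sqrt pi"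
      by (simp add: normal_density_def power_divide real_sqrt_mult field_simps)
    moreover have "exp (b\<^sup>2) * exp (- (x - b)\<^sup>2) = weight (Hermite b) x"
      by (simp add: exp_add[symmetric] power2_eq_square algebra_simps)
    ultimately show "(exp (b\<^sup>2) * sqrt pi) * (x ^ k * normal_density b (1 / sqrt 2) x) = x ^ k * weight (Hermite b) x"
      by (metis (no_types, lifting) mult.assoc mult.commute nonzero_mult_div_cancel_left pi_gt_zero
          real_sqrt_gt_zero less_irrefl times_divide_eq_right)
  qed
  finally show ?thesis .
qed

text \<open>
  The coefficients \<open>a\<close> and \<open>b\<close> of the Pearson equation, which are also those of the classical
  second-order operator.
\<close>

fun pearson_a :: "classical_weight \<Rightarrow> complex poly" where
  "pearson_a (Hermite c) = 1"
| "pearson_a (Laguerre \<alpha>) = [:0, 1:]"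
| "pearson_a (Jacobi \<alpha> \<beta>) = [:1, 0, -1:]"

fun pearson_b :: "classical_weight \<Rightarrow> complex poly" where
  "pearson_b (Hermite c) = [:of_real (2 * c), -2:]"
| "pearson_b (Laguerre \<alpha>) = [:of_real (\<alpha> + 1), -1:]"
| "pearson_b (Jacobi \<alpha> \<beta>) = [:of_real (\<beta> - \<alpha>), - of_real (\<alpha> + \<beta> + 2):]"

lemma pearson_weightI:
  fixes w A B :: "real \<Rightarrow> real" and l u :: ereal
  assumes lu: "l < u" and supp: "\<And>x. x \<notin> einterval l u \<Longrightarrow> w x = 0"
    and pos: "\<And>x. x \<in> einterval l u \<Longrightarrow> w x > 0"
    and int: "\<And>k. integrable lborel (\<lambda>x. x ^ k * w x)"
    and ab: "\<And>x. poly a (complex_of_real x) = of_real (A x)" "\<And>x. poly b (complex_of_real x) = of_real (B x)"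
    and deriv: "\<And>x. x \<in> einterval l u \<Longrightarrow> ((\<lambda>x. A x * w x) has_real_derivative B x * w x) (at x)"
    and cont: "\<And>x. x \<in> einterval l u \<Longrightarrow> isCont w x"
    and lim: "\<And>k. (((\<lambda>x. x ^ k * (A x * w x)) \<circ> real_of_ereal) \<longlongrightarrow> 0) (at_right l)"
      "\<And>k. (((\<lambda>x. x ^ k * (A x * w x)) \<circ> real_of_ereal) \<longlongrightarrow> 0) (at_left u)"
    and deg: "degree a \<le> 2" "degree b \<le> 1" and real: "conj_poly a = a"
    and inj: "inj (hyper_eigenvalue a b)"
  shows "pearson_weight w a b"
proof -
  interpret moment_weight w
  proof
    show "integrable lborel (\<lambda>x. poly p (complex_of_real x) * complex_of_real (w x))" for p
      by (intro integrable_poly_weight int)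
    show "w x \<ge> 0" for x using supp[of x] pos[of x] by (cases "x \<in> einterval l u") auto
    obtain s t where "l < ereal s" "s < t" "ereal t < u"
      using lu by (metis ereal_dense2 ereal_less_eq(3) less_le_not_le linorder_not_le)
    then show "\<exists>s t. s < t \<and> (\<forall>x. s < x \<and> x < t \<longrightarrow> w x > 0)"
      by (intro exI[of _ s] exI[of _ t] conjI allI impI pos)
         (auto simp: einterval_def intro: less_trans[of l "ereal s"] less_trans[of _ "ereal t" u])
  qed
  show ?thesis
  proof
    show "functional (pderiv g * a + g * b) = 0" for g
      unfolding functional_def by (rule pearson_equation[OF lu supp int ab deriv cont lim])
  qed (fact deg real inj)+
qed

lemma classical_pearson:
  assumes "admissible w"
  shows "pearson_weight (weight w) (pearson_a w) (pearson_b w)"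
proof (cases w)
  case (Hermite c)
  show ?thesis unfolding Hermite
  proof (rule pearson_weightI[where l = "-\<infinity>" and u = \<infinity> and A = "\<lambda>_. 1" and B = "\<lambda>x. 2 * c - 2 * x"])
    show "((\<lambda>x. 1 * weight (Hermite c) x) has_real_derivative (2 * c - 2 * x) * weight (Hermite c) x) (at x)" for x
      by (auto intro!: derivative_eq_intros simp: power2_eq_square algebra_simps)
    show "(((\<lambda>x. x ^ k * (1 * weight (Hermite c) x)) \<circ> real_of_ereal) \<longlongrightarrow> 0) (at_right (-\<infinity>))" for k
      unfolding ereal_tendsto_simps weight.simps by real_asymp
    show "(((\<lambda>x. x ^ k * (1 * weight (Hermite c) x)) \<circ> real_of_ereal) \<longlongrightarrow> 0) (at_left \<infinity>)" for k
      unfolding ereal_tendsto_simps weight.simps by real_asymp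
    have "weight (Hermite c) = (\<lambda>x. exp (- x\<^sup>2 + 2 * c * x))" by (rule ext) simp
    then show "isCont (weight (Hermite c)) x" for x by simp
    show "inj (hyper_eigenvalue (pearson_a (Hermite c)) (pearson_b (Hermite c)))"
      by (auto simp: inj_def hyper_eigenvalue_def)
  qed (use hermite_integrable in \<open>auto simp: einterval_def intro!: poly_eqI split: nat.splits simp: coeff_pCons\<close>)
next
  case (Laguerre \<alpha>)
  with assms have \<alpha>: "\<alpha> > -1" by simp
  show ?thesis unfolding Laguerre
  proof (rule pearson_weightI[where l = 0 and u = \<infinity> and A = "\<lambda>x. x" and B = "\<lambda>x. \<alpha> + 1 - x"])
    fix x :: real assume "x \<in> einterval 0 \<infinity>"
    then have x: "x > 0" by (simp add: einterval_def)
    have "((\<lambda>x. x * (exp (- x) * x powr \<alpha>)) has_real_derivative (\<alpha> + 1 - x) * weight (Laguerre \<alpha>) x) (at x)"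
      using x by (auto intro!: derivative_eq_intros simp: algebra_simps powr_diff)
    then show "((\<lambda>x. x * weight (Laguerre \<alpha>) x) has_real_derivative (\<alpha> + 1 - x) * weight (Laguerre \<alpha>) x) (at x)"
      by (rule has_field_derivative_transform_within_open[where S = "{0<..}"]) (use x in auto)
    have "isCont (\<lambda>x. exp (- x) * x powr \<alpha>) x" using x by (intro continuous_intros) auto
    moreover have "eventually (\<lambda>y. exp (- y) * y powr \<alpha> = weight (Laguerre \<alpha>) y) (nhds x)"
      using eventually_nhds_in_open[of "{0<..}" x] x by (auto elim!: eventually_mono)
    ultimately show "isCont (weight (Laguerre \<alpha>)) x" by (simp only: isCont_cong)
  next
    fix k
    have "((\<lambda>x::real. x ^ k * (x * (exp (- x) * x powr \<alpha>))) \<longlongrightarrow> 0) at_top" by real_asymp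
    then have "((\<lambda>x. x ^ k * (x * weight (Laguerre \<alpha>) x)) \<longlongrightarrow> 0) at_top"
      by (rule Lim_transform_eventually) (rule eventually_mono[OF eventually_gt_at_top[of 0]], simp)
    then show "(((\<lambda>x. x ^ k * (x * weight (Laguerre \<alpha>) x)) \<circ> real_of_ereal) \<longlongrightarrow> 0) (at_left \<infinity>)"
      unfolding ereal_tendsto_simps .
    have "((\<lambda>x::real. x ^ k * (x * (exp (- x) * x powr \<alpha>))) \<longlongrightarrow> 0) (at_right 0)" using \<alpha> by real_asymp
    then have "((\<lambda>x. x ^ k * (x * weight (Laguerre \<alpha>) x)) \<longlongrightarrow> 0) (at_right 0)"
      by (rule Lim_transform_eventually)
         (rule eventually_mono[OF eventually_at_right_less[of 0]], simp)
    then show "(((\<lambda>x. x ^ k * (x * weight (Laguerre \<alpha>) x)) \<circ> real_of_ereal) \<longlongrightarrow> 0) (at_right 0)"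
      unfolding zero_ereal_def ereal_tendsto_simps .
  next
    show "inj (hyper_eigenvalue (pearson_a (Laguerre \<alpha>)) (pearson_b (Laguerre \<alpha>)))"
      by (auto simp: inj_def hyper_eigenvalue_def numeral_2_eq_2)
  qed (use laguerre_integrable[OF \<alpha>] in \<open>auto simp: einterval_def intro!: poly_eqI split: nat.splits simp: coeff_pCons\<close>)
next
  case (Jacobi \<alpha> \<beta>)
  with assms have ab: "\<alpha> > -1" "\<beta> > -1" by auto
  let ?w = "weight (Jacobi \<alpha> \<beta>)"
  have prod: "x ^ k * ((1 - x\<^sup>2) * ?w x) = x ^ k * ((1 - x) powr (\<alpha> + 1) * (1 + x) powr (\<beta> + 1))"
    if "-1 < x" "x < 1" for k x
    using that by (simp add: powr_add power2_eq_square algebra_simps)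
  show ?thesis unfolding Jacobi
  proof (rule pearson_weightI[where l = "ereal (-1)" and u = "ereal 1" and A = "\<lambda>x. 1 - x\<^sup>2"
        and B = "\<lambda>x. \<beta> - \<alpha> - (\<alpha> + \<beta> + 2) * x"])
    fix x :: real assume "x \<in> einterval (ereal (-1)) (ereal 1)"
    then have x: "-1 < x" "x < 1" by (simp_all add: einterval_def)
    have "((\<lambda>x. (1 - x) powr (\<alpha> + 1) * (1 + x) powr (\<beta> + 1)) has_real_derivative
        (\<beta> - \<alpha> - (\<alpha> + \<beta> + 2) * x) * ?w x) (at x)"
    proof -
      have "((\<lambda>x. (1 - x) powr (\<alpha> + 1)) has_real_derivative - ((\<alpha> + 1) * (1 - x) powr \<alpha>)) (at x)"
        "((\<lambda>x. (1 + x) powr (\<beta> + 1)) has_real_derivative (\<beta> + 1) * (1 + x) powr \<beta>) (at x)"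
        using x by (auto intro!: derivative_eq_intros)
      from DERIV_mult[OF this] show ?thesis
        by (rule DERIV_cong) (use x in \<open>simp add: powr_add algebra_simps\<close>)
    qed
    then show "((\<lambda>x. (1 - x\<^sup>2) * ?w x) has_real_derivative (\<beta> - \<alpha> - (\<alpha> + \<beta> + 2) * x) * ?w x) (at x)"
      by (rule has_field_derivative_transform_within_open[where S = "{-1<..<1}"])
         (use x prod[of _ 0] in auto)
    have "isCont (\<lambda>x. (1 - x) powr \<alpha> * (1 + x) powr \<beta>) x" using x by (intro continuous_intros) auto
    moreover have "eventually (\<lambda>y. (1 - y) powr \<alpha> * (1 + y) powr \<beta> = ?w y) (nhds x)"
      using eventually_nhds_in_open[of "{-1<..<1}" x] x by (auto elim!: eventually_mono)
    ultimately show "isCont ?w x" by (simp only: isCont_cong)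
  next
    fix k
    have "((\<lambda>x::real. (1 - x) powr (\<alpha> + 1)) \<longlongrightarrow> 0) (at_left 1)"
      using ab by (intro tendsto_zero_powrI[where b = "\<alpha> + 1"]) (auto intro!: tendsto_eq_intros simp: eventually_at_left_field intro: exI[of _ 0])
    then have "((\<lambda>x::real. x ^ k * ((1 - x) powr (\<alpha> + 1) * (1 + x) powr (\<beta> + 1))) \<longlongrightarrow> 1 ^ k * (0 * (1 + 1) powr (\<beta> + 1))) (at_left 1)"
      by (intro tendsto_intros) auto
    then have "((\<lambda>x::real. x ^ k * ((1 - x) powr (\<alpha> + 1) * (1 + x) powr (\<beta> + 1))) \<longlongrightarrow> 0) (at_left 1)"
      by simp
    then have "((\<lambda>x. x ^ k * ((1 - x\<^sup>2) * ?w x)) \<longlongrightarrow> 0) (at_left 1)"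
      by (rule Lim_transform_eventually)
         (rule eventually_mono[OF eventually_at_left_real[of "-1" 1]], simp_all add: prod del: weight.simps)
    then show "(((\<lambda>x. x ^ k * ((1 - x\<^sup>2) * ?w x)) \<circ> real_of_ereal) \<longlongrightarrow> 0) (at_left (ereal 1))"
      unfolding ereal_tendsto_simps .
    have "((\<lambda>x::real. (1 + x) powr (\<beta> + 1)) \<longlongrightarrow> 0) (at_right (-1))"
      using ab by (intro tendsto_zero_powrI[where b = "\<beta> + 1"]) (auto intro!: tendsto_eq_intros simp: eventually_at_right_field intro: exI[of _ 0])
    then have "((\<lambda>x::real. x ^ k * ((1 - x) powr (\<alpha> + 1) * (1 + x) powr (\<beta> + 1))) \<longlongrightarrow> (-1) ^ k * ((1 - (-1)) powr (\<alpha> + 1) * 0)) (at_right (-1))"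
      by (intro tendsto_intros) auto
    then have "((\<lambda>x::real. x ^ k * ((1 - x) powr (\<alpha> + 1) * (1 + x) powr (\<beta> + 1))) \<longlongrightarrow> 0) (at_right (-1))"
      by simp
    then have "((\<lambda>x. x ^ k * ((1 - x\<^sup>2) * ?w x)) \<longlongrightarrow> 0) (at_right (-1))"
      by (rule Lim_transform_eventually)
         (rule eventually_mono[OF eventually_at_right_real[of "-1" 1]], simp_all add: prod del: weight.simps)
    then show "(((\<lambda>x. x ^ k * ((1 - x\<^sup>2) * ?w x)) \<circ> real_of_ereal) \<longlongrightarrow> 0) (at_right (ereal (-1)))"
      unfolding ereal_tendsto_simps .
  next
    show "poly (pearson_b (Jacobi \<alpha> \<beta>)) (complex_of_real x)
        = of_real (\<beta> - \<alpha> - (\<alpha> + \<beta> + 2) * x)" for x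
      by (simp add: algebra_simps)
    let ?eig = "hyper_eigenvalue (pearson_a (Jacobi \<alpha> \<beta>)) (pearson_b (Jacobi \<alpha> \<beta>))"
    have eig: "?eig n = of_real (- real n * (real n + \<alpha> + \<beta> + 1))" for n
      by (simp add: hyper_eigenvalue_def numeral_2_eq_2 algebra_simps)
    show "inj ?eig"
    proof (rule injI)
      fix m n assume "?eig m = ?eig n"
      then have "real m * (real m + \<alpha> + \<beta> + 1) = real n * (real n + \<alpha> + \<beta> + 1)"
        unfolding eig of_real_eq_iff by simp
      then have "(real m - real n) * (real m + real n + \<alpha> + \<beta> + 1) = 0"
        by (simp add: algebra_simps)
      moreover have "real m + real n + \<alpha> + \<beta> + 1 > 0" if "m \<noteq> n"
      proof -
        have "m + n \<ge> 1" using that by auto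
        then have "real m + real n \<ge> 1" by linarith
        then show ?thesis using ab by linarith
      qed
      ultimately show "m = n" by force
    qed
  qed (use jacobi_integrable[OF ab] in \<open>auto simp: einterval_def power2_eq_square intro!: poly_eqI split: nat.splits simp: coeff_pCons\<close>)
qed

section \<open>Intertwining operators between classical weights\<close>

text \<open>
  The Hermite, Laguerre and Jacobi differential operators.
\<close>

abbreviation classical_op :: "classical_weight \<Rightarrow> scalar_op" where
  "classical_op w \<equiv> hyper_op (pearson_a w) (pearson_b w)"

abbreviation mops :: "classical_weight \<Rightarrow> nat \<Rightarrow> complex poly" where
  "mops w \<equiv> scalar_mops (weight w)"

lemma classical_system:
  "admissible w \<Longrightarrow> hypergeometric_system (pearson_a w) (pearson_b w) (mops w)"
  using classical_pearson pearson_weight.hypergeometric by blast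

lemma scalar_D_eq: "scalar_D (weight w) = {L \<in> scalar_ops. intertwines L (mops w) (mops w)}"
  by (auto simp: scalar_D_def intertwines_def)

lemma of_nat_add_of_real_nonzero: "\<mu> > 0 \<Longrightarrow> of_nat j + complex_of_real \<mu> \<noteq> 0"
proof -
  assume "\<mu> > 0"
  then have "real j + \<mu> \<noteq> 0" by linarith
  then have "complex_of_real (real j + \<mu>) \<noteq> 0" unfolding of_real_eq_0_iff .
  then show ?thesis by simp
qed

text \<open>
  The zeros of \<open>a\<close>: the end point \<open>0\<close> for Laguerre weights, the end points \<open>1\<close> and \<open>-1\<close> for Jacobi
  weights. Hermite weights have none.
\<close>

lemma laguerre_singular_point:
  assumes "\<alpha> > -1"
  shows "singular_point (pearson_a (Laguerre \<alpha>)) (pearson_b (Laguerre \<alpha>)) (mops (Laguerre \<alpha>)) 0 1 (of_real (\<alpha> + 1))"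
  using classical_system[of "Laguerre \<alpha>"] of_nat_add_of_real_nonzero[of "\<alpha> + 1"] assms
  by (auto simp: pderiv_pCons intro!: singular_point.intro singular_point_axioms.intro)

lemma jacobi_singular_point_right:
  assumes "\<alpha> > -1" "\<beta> > -1"
  shows "singular_point (pearson_a (Jacobi \<alpha> \<beta>)) (pearson_b (Jacobi \<alpha> \<beta>)) (mops (Jacobi \<alpha> \<beta>)) 1 (-2) (of_real (\<alpha> + 1))"
  using classical_system[of "Jacobi \<alpha> \<beta>"] of_nat_add_of_real_nonzero[of "\<alpha> + 1"] assms
  by (auto simp: pderiv_pCons algebra_simps intro!: singular_point.intro singular_point_axioms.intro)

lemma jacobi_singular_point_left:
  assumes "\<alpha> > -1" "\<beta> > -1"
  shows "singular_point (pearson_a (Jacobi \<alpha> \<beta>)) (pearson_b (Jacobi \<alpha> \<beta>)) (mops (Jacobi \<alpha> \<beta>)) (-1) 2 (of_real (\<beta> + 1))"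
  using classical_system[of "Jacobi \<alpha> \<beta>"] of_nat_add_of_real_nonzero[of "\<beta> + 1"] assms
  by (auto simp: pderiv_pCons algebra_simps intro!: singular_point.intro singular_point_axioms.intro)

subsection \<open>The explicit intertwining operators\<close>

lemma poly_op_eqI: "(\<And>p x. poly (L p) x = poly (M p) x) \<Longrightarrow> L = (M :: scalar_op)"
  by (intro ext) (simp add: poly_eq_poly_eq_iff[symmetric] fun_eq_iff)

text \<open>
  The identity \<open>\<delta>T = T\<delta>'\<close>, kept as a predicate because it composes along a chain of parameters.
\<close>

definition commutes_through :: "scalar_op \<Rightarrow> scalar_op \<Rightarrow> scalar_op \<Rightarrow> bool" where
  "commutes_through D T D' \<longleftrightarrow> D \<odot> T = T \<odot> D'"

lemma commutes_through_id: "commutes_through D (\<lambda>p. p) D"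
  by (simp add: commutes_through_def op_mult_def)

lemma commutes_through_compose:
  "commutes_through D T D' \<Longrightarrow> commutes_through D' S D'' \<Longrightarrow> commutes_through D (T \<odot> S) D''"
  by (simp add: commutes_through_def op_mult_def fun_eq_iff)

lemmas commutation_simps = commutes_through_def op_mult_def hyper_op_def first_order_def pderiv_add pderiv_minus
  pderiv_diff pderiv_mult pderiv_smult pderiv_pCons algebra_simps

text \<open>
  Shifting a parameter by one. The factors of the explicit operators occur in the order in which these
  steps are composed.
\<close>

lemma laguerre_raise_step:
  "commutes_through (classical_op (Laguerre \<alpha>)) (\<lambda>p. - pderiv p + p) (classical_op (Laguerre (\<alpha> + 1)))"
  unfolding commutes_through_def by (rule poly_op_eqI) (simp add: commutation_simps)

lemma laguerre_lower_step:
  "commutes_through (classical_op (Laguerre (\<alpha> + 1))) (first_order [:0, 1:] (\<alpha> + 1)) (classical_op (Laguerre \<alpha>))"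
  unfolding commutes_through_def by (rule poly_op_eqI) (simp add: commutation_simps)

lemma jacobi_raise_step:
  "commutes_through (classical_op (Jacobi \<alpha> (\<beta> + 1))) (first_order [:1, 1:] (\<beta> + 1)) (classical_op (Jacobi (\<alpha> + 1) \<beta>))"
  unfolding commutes_through_def by (rule poly_op_eqI) (simp add: commutation_simps)

lemma jacobi_lower_step:
  "commutes_through (classical_op (Jacobi (\<alpha> + 1) \<beta>)) (first_order [:-1, 1:] (\<alpha> + 1)) (classical_op (Jacobi \<alpha> (\<beta> + 1)))"
  unfolding commutes_through_def by (rule poly_op_eqI) (simp add: commutation_simps)

lemma op_prod_rev_0: "op_prod (map f (rev [1..<Suc 0])) = id"
  by (simp add: op_prod_def)

lemma op_prod_rev_Suc:
  "op_prod (map f (rev [1..<Suc (Suc k)])) = f (Suc k) \<odot> op_prod (map f (rev [1..<Suc k]))"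
  by (simp add: op_prod_def)

lemma commutes_laguerre_raise:
  "commutes_through (classical_op (Laguerre \<alpha>)) ((\<lambda>p. - pderiv p + p) ^^ k) (classical_op (Laguerre (\<alpha> + real k)))"
proof (induction k)
  case 0 show ?case using commutes_through_id[of "classical_op (Laguerre \<alpha>)"] by (simp add: id_def del: pearson_a.simps pearson_b.simps)
next
  case (Suc k)
  have "(\<lambda>p :: complex poly. - pderiv p + p) ^^ Suc k = ((\<lambda>p. - pderiv p + p) ^^ k) \<odot> (\<lambda>p. - pderiv p + p)"
    by (simp add: op_mult_def o_def)
  moreover have "\<alpha> + real (Suc k) = \<alpha> + real k + 1" by simp
  ultimately show ?case
    using commutes_through_compose[OF Suc.IH laguerre_raise_step] by (simp only:)
qed

lemma commutes_laguerre_lower: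
  "commutes_through (classical_op (Laguerre (\<alpha> + real k)))
     (op_prod (map (\<lambda>i. first_order [:0, 1:] (\<alpha> + real i)) (rev [1..<Suc k]))) (classical_op (Laguerre \<alpha>))"
proof (induction k)
  case 0 show ?case unfolding op_prod_rev_0 using commutes_through_id[of "classical_op (Laguerre \<alpha>)"]
    by (simp add: id_def del: pearson_a.simps pearson_b.simps)
next
  case (Suc k)
  have "\<alpha> + real (Suc k) = \<alpha> + real k + 1" by simp
  then show ?case unfolding op_prod_rev_Suc
    using commutes_through_compose[OF laguerre_lower_step Suc.IH] by (simp only:)
qed

lemma commutes_jacobi_raise:
  "commutes_through (classical_op (Jacobi \<alpha> (\<beta> + real k)))
     (op_prod (map (\<lambda>i. first_order [:1, 1:] (\<beta> + real i)) (rev [1..<Suc k]))) (classical_op (Jacobi (\<alpha> + real k) \<beta>))"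
proof (induction k arbitrary: \<alpha>)
  case 0 show ?case unfolding op_prod_rev_0 using commutes_through_id[of "classical_op (Jacobi \<alpha> \<beta>)"]
    by (simp add: id_def del: pearson_a.simps pearson_b.simps)
next
  case (Suc k)
  have "\<beta> + real (Suc k) = \<beta> + real k + 1" "\<alpha> + real (Suc k) = \<alpha> + 1 + real k" by simp_all
  then show ?case unfolding op_prod_rev_Suc
    using commutes_through_compose[OF jacobi_raise_step Suc.IH, of \<alpha>] by (simp only:)
qed

lemma commutes_jacobi_lower:
  "commutes_through (classical_op (Jacobi (\<alpha> + real k) \<beta>))
     (op_prod (map (\<lambda>i. first_order [:-1, 1:] (\<alpha> + real i)) (rev [1..<Suc k]))) (classical_op (Jacobi \<alpha> (\<beta> + real k)))"
proof (induction k arbitrary: \<beta>)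
  case 0 show ?case unfolding op_prod_rev_0 using commutes_through_id[of "classical_op (Jacobi \<alpha> \<beta>)"]
    by (simp add: id_def del: pearson_a.simps pearson_b.simps)
next
  case (Suc k)
  have "\<alpha> + real (Suc k) = \<alpha> + real k + 1" "\<beta> + real (Suc k) = \<beta> + 1 + real k" by simp_all
  then show ?case unfolding op_prod_rev_Suc
    using commutes_through_compose[OF jacobi_lower_step Suc.IH, of \<beta>] by (simp only:)
qed

text \<open>
  At a zero of \<open>f\<close> the operator \<open>\<partial>f + c\<close> reduces to multiplication by \<open>c\<close>; with \<open>c > -1\<close>, none of the shifted
  constants vanishes.
\<close>

lemma op_prod_first_order_eval:
  assumes "c > -1" "poly f x0 = 0"
  shows "\<exists>\<tau>. \<tau> \<noteq> 0 \<and> (\<forall>r. poly (op_prod (map (\<lambda>i. first_order f (c + real i)) (rev [1..<Suc k])) r) x0 = \<tau> * poly r x0)"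
proof (induction k)
  case 0 show ?case unfolding op_prod_rev_0 by (intro exI[of _ 1]) simp
next
  case (Suc k)
  then obtain \<tau> where \<tau>: "\<tau> \<noteq> 0"
    "\<And>r. poly (op_prod (map (\<lambda>i. first_order f (c + real i)) (rev [1..<Suc k])) r) x0 = \<tau> * poly r x0" by blast
  have "c + real (Suc k) \<noteq> 0" using assms(1) by auto
  then have "complex_of_real (c + real (Suc k)) \<noteq> 0" unfolding of_real_eq_0_iff .
  moreover have "poly (first_order f (c + real (Suc k)) r) x0 = complex_of_real (c + real (Suc k)) * poly r x0" for r
    by (simp add: first_order_def assms(2))
  ultimately show ?case unfolding op_prod_rev_Suc
    by (intro exI[of _ "\<tau> * complex_of_real (c + real (Suc k))"])
       (simp only: \<tau> op_mult_def mult_eq_0_iff mult.assoc simp_thms)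
qed

lemma degree_preservingI:
  assumes "\<And>p. degree (L p) \<le> degree p" "\<And>p. p \<noteq> 0 \<Longrightarrow> coeff (L p) (degree p) \<noteq> 0"
  shows "degree_preserving L"
  unfolding degree_preserving_def
  using assms le_degree[OF assms(2)] by (metis antisym coeff_0)

lemma degree_preserving_id: "degree_preserving id"
  by (simp add: degree_preserving_def)

lemma degree_preserving_compose:
  "degree_preserving L \<Longrightarrow> degree_preserving M \<Longrightarrow> degree_preserving (L \<odot> M)"
  by (simp add: degree_preserving_def op_mult_def)

lemma degree_preserving_first_order:
  assumes "c > 0" shows "degree_preserving (first_order [:d, 1:] c)"
proof (rule degree_preservingI)
  fix p :: "complex poly"
  show "degree (first_order [:d, 1:] c p) \<le> degree p"
  proof (cases "degree p = 0")
    case True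
    then have "pderiv p = 0" by (simp add: pderiv_eq_0_iff)
    then show ?thesis by (simp add: first_order_def)
  next
    case False
    have "degree (pderiv p * [:d, 1:]) \<le> degree (pderiv p) + 1"
      by (rule order_trans[OF degree_mult_le]) simp
    also have "\<dots> = degree p" using False by (simp add: degree_pderiv)
    finally show ?thesis unfolding first_order_def
      by (intro degree_add_le) (auto intro: order_trans[OF degree_smult_le])
  qed
  assume p: "p \<noteq> 0"
  have "coeff (pderiv p * [:d, 1:]) (degree p) = of_nat (degree p) * lead_coeff p"
    by (cases "degree p") (simp_all add: coeff_pderiv coeff_eq_0 mult.commute[of "pderiv p"] pderiv_eq_0_iff)
  then have "coeff (first_order [:d, 1:] c p) (degree p) = (of_nat (degree p) + of_real c) * lead_coeff p"
    by (simp add: first_order_def algebra_simps)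
  then show "coeff (first_order [:d, 1:] c p) (degree p) \<noteq> 0"
    using p of_nat_add_of_real_nonzero[OF assms] by simp
qed

lemma degree_preserving_op_prod:
  assumes "c > -1"
  shows "degree_preserving (op_prod (map (\<lambda>i. first_order [:d, 1:] (c + real i)) (rev [1..<Suc k])))"
proof (induction k)
  case 0 show ?case unfolding op_prod_rev_0 by (rule degree_preserving_id)
next
  case (Suc k)
  then show ?case unfolding op_prod_rev_Suc using assms
    by (intro degree_preserving_compose degree_preserving_first_order) auto
qed


lemma coeff_raise_power:
  assumes "degree p \<le> n"
  shows "degree (((\<lambda>p :: complex poly. - pderiv p + p) ^^ k) p) \<le> n \<and>
    coeff (((\<lambda>p. - pderiv p + p) ^^ k) p) n = coeff p n"
proof (induction k)
  case 0 show ?case using assms by simp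
next
  case (Suc k)
  then show ?case
    by (auto simp: coeff_pderiv coeff_eq_0 degree_pderiv intro!: degree_diff_le)
qed

lemma degree_preserving_raise: "degree_preserving ((\<lambda>p. - pderiv p + p) ^^ k)"
  by (rule degree_preservingI) (use coeff_raise_power[OF order_refl] in auto)

lemma scalar_ops_raise: "(\<lambda>p. - pderiv p + p) ^^ k \<in> scalar_ops"
  by (intro scalar_ops_funpow scalar_ops_plus scalar_ops_uminus scalar_ops_pderiv scalar_ops_id)

lemma scalar_ops_first_order_prod:
  "op_prod (map (\<lambda>i. first_order f (c + real i)) xs) \<in> scalar_ops"
  by (rule scalar_ops_op_prod) (auto intro: scalar_ops_first_order)


subsection \<open>Equivalent parameters\<close>

text \<open>
  The parameter conditions for Darboux equivalence.
\<close>

fun equivalent :: "classical_weight \<Rightarrow> classical_weight \<Rightarrow> bool" where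
  "equivalent (Hermite b) (Hermite b') \<longleftrightarrow> b = b'"
| "equivalent (Laguerre \<alpha>) (Laguerre \<alpha>') \<longleftrightarrow> \<alpha> - \<alpha>' \<in> \<int>"
| "equivalent (Jacobi \<alpha> \<beta>) (Jacobi \<alpha>' \<beta>') \<longleftrightarrow> \<alpha> + \<beta> = \<alpha>' + \<beta>' \<and> \<alpha> - \<alpha>' \<in> \<int>"
| "equivalent _ _ \<longleftrightarrow> False"

lemma equivalent_sym: "equivalent w w' \<Longrightarrow> equivalent w' w"
  using minus_in_Ints_iff[of "x - y" for x y :: real]
  by (induction w w' rule: equivalent.induct) auto

text \<open>
  Two different equivalent weights differ by a shift in one of two directions; these are the argument
  patterns of the explicit operators.
\<close>

lemma equivalent_cases:
  assumes "equivalent w w'" "w \<noteq> w'"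
  obtains (laguerre_raise) \<alpha> k where "w = Laguerre \<alpha>" "w' = Laguerre (\<alpha> + real k)"
  | (laguerre_lower) \<alpha> k where "w = Laguerre (\<alpha> + real k)" "w' = Laguerre \<alpha>"
  | (jacobi_raise) \<alpha> \<beta> k where "w = Jacobi \<alpha> (\<beta> + real k)" "w' = Jacobi (\<alpha> + real k) \<beta>"
  | (jacobi_lower) \<alpha> \<beta> k where "w = Jacobi (\<alpha> + real k) \<beta>" "w' = Jacobi \<alpha> (\<beta> + real k)"
proof -
  have int: "(\<exists>k. y = x + real k) \<or> (\<exists>k. x = y + real k)" if d: "x - y \<in> \<int>" for x y :: real
  proof -
    obtain i where i: "x - y = of_int i" using d by (rule Ints_cases)
    show ?thesis
    proof (cases "i \<ge> 0")
      case True
      then have "x = y + real (nat i)" using i by simp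
      then show ?thesis by blast
    next
      case False
      then have "y = x + real (nat (- i))" using i by simp
      then show ?thesis by blast
    qed
  qed
  show thesis
  proof (cases w)
    case (Hermite b)
    then show ?thesis using assms by (cases w') auto
  next
    case (Laguerre \<alpha>)
    then obtain \<alpha>' where w': "w' = Laguerre \<alpha>'" "\<alpha> - \<alpha>' \<in> \<int>" using assms by (cases w') auto
    then show ?thesis using int[OF w'(2)] Laguerre laguerre_raise laguerre_lower by blast
  next
    case (Jacobi \<alpha> \<beta>)
    then obtain \<alpha>' \<beta>' where w': "w' = Jacobi \<alpha>' \<beta>'" "\<alpha> - \<alpha>' \<in> \<int>" "\<alpha> + \<beta> = \<alpha>' + \<beta>'"
      using assms by (cases w') auto
    from int[OF w'(2)] show ?thesis
    proof
      assume "\<exists>k. \<alpha>' = \<alpha> + real k"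
      then obtain k where k: "\<alpha>' = \<alpha> + real k" by blast
      then have "\<beta> = \<beta>' + real k" using w'(3) by simp
      then show ?thesis using jacobi_raise[of \<alpha> \<beta>' k] k w'(1) Jacobi by simp
    next
      assume "\<exists>k. \<alpha> = \<alpha>' + real k"
      then obtain k where k: "\<alpha> = \<alpha>' + real k" by blast
      then have "\<beta>' = \<beta> + real k" using w'(3) by simp
      then show ?thesis using jacobi_lower[of \<alpha>' k \<beta>] k w'(1) Jacobi by simp
    qed
  qed
qed

lemma eigenvalue_laguerre: "hyper_eigenvalue (pearson_a (Laguerre \<alpha>)) (pearson_b (Laguerre \<alpha>)) n = - of_nat n"
  by (simp add: hyper_eigenvalue_def numeral_2_eq_2)

lemma eigenvalue_jacobi: "hyper_eigenvalue (pearson_a (Jacobi \<alpha> \<beta>)) (pearson_b (Jacobi \<alpha> \<beta>)) n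
    = - (of_nat n * (of_nat n + of_real (\<alpha> + \<beta> + 1)))"
  by (simp add: hyper_eigenvalue_def numeral_2_eq_2 algebra_simps)

lemma eigenvalue_hermite: "hyper_eigenvalue (pearson_a (Hermite c)) (pearson_b (Hermite c)) n = - 2 * of_nat n"
  by (simp add: hyper_eigenvalue_def numeral_2_eq_2)

lemma equivalent_isospectral:
  assumes "admissible w" "admissible w'" "equivalent w w'"
  shows "isospectral_pair (pearson_a w) (pearson_b w) (mops w) (pearson_a w') (pearson_b w') (mops w')"
proof -
  have "hyper_eigenvalue (pearson_a w) (pearson_b w) = hyper_eigenvalue (pearson_a w') (pearson_b w')"
    using assms(3)
    by (induction w w' rule: equivalent.induct)
       (auto simp: fun_eq_iff eigenvalue_laguerre eigenvalue_jacobi simp del: pearson_a.simps pearson_b.simps)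
  then show ?thesis
    by (intro isospectral_pair.intro isospectral_pair_axioms.intro hypergeometric_pair.intro
        classical_system assms)
qed

lemma intertwines_commutes:
  assumes "admissible w" "admissible w'" "equivalent w w'" "T \<in> scalar_ops"
    and "commutes_through (classical_op w) T (classical_op w')"
  shows "intertwines T (mops w) (mops w')"
proof -
  interpret isospectral_pair "pearson_a w" "pearson_b w" "mops w" "pearson_a w'" "pearson_b w'" "mops w'"
    by (rule equivalent_isospectral) fact+
  show ?thesis
    using tgt.intertwinesI[OF scalar_ops_linear[OF assms(4)], of "pearson_a w" "pearson_b w" "mops w"]
      src.eigen same_eigenvalues assms(5) by (simp add: commutes_through_def)
qed

text \<open>
  Which point trivialises the multiplier depends on the direction: infinity for \<open>(-\<partial> + 1)\<^sup>k\<close>, and the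
  zero of \<open>f\<close> for the products of factors \<open>\<partial>f + c\<close>, that is \<open>0\<close> for Laguerre weights, \<open>-1\<close> when \<open>\<alpha>\<close>
  increases and \<open>1\<close> when \<open>\<alpha>\<close> decreases for Jacobi weights.
\<close>

lemma explicit_T_properties:
  assumes adm: "admissible w" "admissible w'" and eq: "equivalent w w'" "w \<noteq> w'"
  shows explicit_T_ops: "explicit_T w w' \<in> scalar_ops"
    and explicit_T_degree: "degree_preserving (explicit_T w w')"
    and explicit_T_intertwines: "intertwines (explicit_T w w') (mops w) (mops w')"
    and explicit_T_factor: "L \<in> scalar_ops \<Longrightarrow> intertwines L (mops w) (mops w') \<Longrightarrow>
      \<exists>d\<in>scalar_ops. intertwines d (mops w') (mops w') \<and> L = explicit_T w w' \<odot> d"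
proof -
  interpret isospectral_pair "pearson_a w" "pearson_b w" "mops w" "pearson_a w'" "pearson_b w'" "mops w'"
    by (rule equivalent_isospectral) fact+
  let ?T = "explicit_T w w'"
  have "?T \<in> scalar_ops \<and> degree_preserving ?T \<and> commutes_through (classical_op w) ?T (classical_op w')"
    using eq
  proof (cases rule: equivalent_cases)
    case (laguerre_raise \<alpha> k)
    then show ?thesis using scalar_ops_raise degree_preserving_raise commutes_laguerre_raise
      by (simp only: explicit_T_Laguerre)
  next
    case (laguerre_lower \<alpha> k)
    then show ?thesis
      using scalar_ops_first_order_prod degree_preserving_op_prod commutes_laguerre_lower adm
      by (simp only: explicit_T_Laguerre admissible.simps)
  next
    case (jacobi_raise \<alpha> \<beta> k)
    then show ?thesis
      using scalar_ops_first_order_prod degree_preserving_op_prod commutes_jacobi_raise adm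
      by (simp only: explicit_T_Jacobi admissible.simps)
  next
    case (jacobi_lower \<alpha> \<beta> k)
    then show ?thesis
      using scalar_ops_first_order_prod degree_preserving_op_prod commutes_jacobi_lower adm
      by (simp only: explicit_T_Jacobi admissible.simps)
  qed
  then show T: "?T \<in> scalar_ops" "degree_preserving ?T"
    and tw: "intertwines ?T (mops w) (mops w')"
    using intertwines_commutes[OF adm eq(1)] by auto
  assume L: "L \<in> scalar_ops" "intertwines L (mops w) (mops w')"
  note eval = factor_by_evaluation[OF _ T(1) tw _ _ L]
  from eq show "\<exists>d\<in>scalar_ops. intertwines d (mops w') (mops w') \<and> L = ?T \<odot> d"
  proof (cases rule: equivalent_cases)
    case (laguerre_raise \<alpha> k)
    then have Tk: "?T = (\<lambda>p. - pderiv p + p) ^^ k" by (simp only: explicit_T_Laguerre)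
    obtain C where C: "\<And>n. L (mops w n) = smult (poly C (of_nat n)) (mops w' n)"
      using leading_coefficient_polynomial[OF L] by blast
    have Tn: "?T (mops w n) = mops w' n" for n
    proof -
      obtain t where t: "?T (mops w n) = smult t (mops w' n)" using tw by (auto simp: intertwines_def)
      have "coeff (?T (mops w n)) n = 1"
        using coeff_raise_power[of "mops w n" n k] by (simp add: Tk)
      then show ?thesis using t by simp
    qed
    have "src.eig n = - of_nat n" for n
      unfolding laguerre_raise(1) by (rule eigenvalue_laguerre)
    then show ?thesis
      by (intro factor_through[where E = "pcompose C [:0, -1:]"] T tw L) (simp add: C Tn poly_pcompose)
  next
  case (laguerre_lower \<alpha> k)
    have "singular_point (pearson_a w) (pearson_b w) (mops w) 0 1 (of_real (\<alpha> + real k + 1))"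
      unfolding laguerre_lower(1) by (rule laguerre_singular_point) (use adm in \<open>auto simp: laguerre_lower\<close>)
    moreover have "\<exists>\<tau>. \<tau> \<noteq> 0 \<and> (\<forall>r. poly (?T r) (0) = \<tau> * poly r (0))"
      unfolding laguerre_lower explicit_T_Laguerre
      by (rule op_prod_first_order_eval) (use adm in \<open>auto simp: laguerre_lower\<close>)
    ultimately show ?thesis using eval by blast
  next
    case (jacobi_raise \<alpha> \<beta> k)
    have "singular_point (pearson_a w) (pearson_b w) (mops w) (-1) 2 (of_real (\<beta> + real k + 1))"
      unfolding jacobi_raise(1) by (rule jacobi_singular_point_left) (use adm in \<open>auto simp: jacobi_raise\<close>)
    moreover have "\<exists>\<tau>. \<tau> \<noteq> 0 \<and> (\<forall>r. poly (?T r) (-1) = \<tau> * poly r (-1))"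
      unfolding jacobi_raise explicit_T_Jacobi
      by (rule op_prod_first_order_eval) (use adm in \<open>auto simp: jacobi_raise\<close>)
    ultimately show ?thesis using eval by blast
  next
    case (jacobi_lower \<alpha> \<beta> k)
    have "singular_point (pearson_a w) (pearson_b w) (mops w) 1 (-2) (of_real (\<alpha> + real k + 1))"
      unfolding jacobi_lower(1) by (rule jacobi_singular_point_right) (use adm in \<open>auto simp: jacobi_lower\<close>)
    moreover have "\<exists>\<tau>. \<tau> \<noteq> 0 \<and> (\<forall>r. poly (?T r) (1) = \<tau> * poly r (1))"
      unfolding jacobi_lower explicit_T_Jacobi
      by (rule op_prod_first_order_eval) (use adm in \<open>auto simp: jacobi_lower\<close>)
    ultimately show ?thesis using eval by blast
  qed
qed

subsection \<open>Inequivalent weights\<close>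

text \<open>
  Comparing the multipliers at \<open>0\<close> and at infinity: \<open>e(-n) (\<alpha>+1)\<^sub>n = C(n) (\<alpha>'+1)\<^sub>n\<close> with polynomials \<open>e\<close> and
  \<open>C\<close>. The second pair of Pochhammer symbols in the general lemma is filled with \<open>(1)\<^sub>n\<close>.
\<close>

lemma no_intertwiner_laguerre:
  assumes adm: "\<alpha> > -1" "\<alpha>' > -1" and ne: "\<alpha> - \<alpha>' \<notin> \<int>"
    and L: "L \<in> scalar_ops" "intertwines L (mops (Laguerre \<alpha>)) (mops (Laguerre \<alpha>'))"
  shows "L = (\<lambda>_. 0)"
proof -
  let ?w = "Laguerre \<alpha>" and ?w' = "Laguerre \<alpha>'"
  interpret hypergeometric_pair "pearson_a ?w" "pearson_b ?w" "mops ?w" "pearson_a ?w'" "pearson_b ?w'" "mops ?w'"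
    by (intro hypergeometric_pair.intro classical_system) (use adm in auto)
  interpret isospectral_pair "pearson_a ?w" "pearson_b ?w" "mops ?w" "pearson_a ?w'" "pearson_b ?w'" "mops ?w'"
    by unfold_locales (simp add: fun_eq_iff eigenvalue_laguerre del: pearson_a.simps pearson_b.simps)
  obtain C where C: "\<And>n. L (mops ?w n) = smult (poly C (of_nat n)) (mops ?w' n)"
    using leading_coefficient_polynomial[OF L] by blast
  obtain e where e: "\<And>n. poly e (- of_nat n) * pochhammer (of_real (\<alpha> + 1)) n
      = poly C (of_nat n) * pochhammer (of_real (\<alpha>' + 1)) n"
    using multiplier_at_singular_point[OF laguerre_singular_point laguerre_singular_point L(1) C] adm
    unfolding eigenvalue_laguerre by blast
  define E where "E = pcompose e [:0, -1:]"
  have E: "poly E (of_nat n) * of_real (pochhammer (\<alpha> + 1) n * pochhammer 1 n)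
      = poly C (of_nat n) * of_real (pochhammer (\<alpha>' + 1) n * pochhammer 1 n)" for n
    using e[of n] by (simp add: E_def poly_pcompose pochhammer_of_real[symmetric] del: of_real_add)
  have "E = 0"
  proof (rule ccontr)
    assume "E \<noteq> 0"
    from pochhammer_ratio_rational[OF _ _ _ _ E this] adm
    have "\<alpha> - \<alpha>' = real (degree C) - real (degree E)" by simp
    then have "\<alpha> - \<alpha>' \<in> \<int>" by simp
    with ne show False by contradiction
  qed
  have "L (mops ?w n) = 0" for n
  proof -
    have "pochhammer (\<alpha>' + 1) n > 0" "pochhammer (1::real) n > 0" using adm by (auto intro!: pochhammer_pos)
    then show ?thesis using E[of n] \<open>E = 0\<close> C[of n] by simp
  qed
  then show ?thesis by (rule intertwiner_zeroI[OF L(1)])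
qed

text \<open>
  Comparing the multipliers at \<open>1\<close> and \<open>-1\<close>. The growth exponent is \<open>2(\<alpha> - \<alpha>')\<close>, and it is even because
  both polynomials depend on \<open>n\<close> only through the quadratic \<open>\<lambda>\<^sub>n\<close>.
\<close>

lemma no_intertwiner_jacobi_isospectral:
  assumes adm: "\<alpha> > -1" "\<beta> > -1" "\<alpha>' > -1" "\<beta>' > -1"
    and same: "\<alpha> + \<beta> = \<alpha>' + \<beta>'" and ne: "\<alpha> - \<alpha>' \<notin> \<int>"
    and L: "L \<in> scalar_ops" "intertwines L (mops (Jacobi \<alpha> \<beta>)) (mops (Jacobi \<alpha>' \<beta>'))"
  shows "L = (\<lambda>_. 0)"
proof -
  let ?w = "Jacobi \<alpha> \<beta>" and ?w' = "Jacobi \<alpha>' \<beta>'"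
  interpret hypergeometric_pair "pearson_a ?w" "pearson_b ?w" "mops ?w" "pearson_a ?w'" "pearson_b ?w'" "mops ?w'"
    by (intro hypergeometric_pair.intro classical_system) (use adm in auto)
  interpret isospectral_pair "pearson_a ?w" "pearson_b ?w" "mops ?w" "pearson_a ?w'" "pearson_b ?w'" "mops ?w'"
    by unfold_locales (simp add: fun_eq_iff eigenvalue_jacobi same del: pearson_a.simps pearson_b.simps of_real_add)
  obtain c where c: "\<And>n. L (mops ?w n) = smult (c n) (mops ?w' n)"
    using L(2) unfolding intertwines_def by metis
  define \<Lambda> :: "complex poly" where "\<Lambda> = [:0, - of_real (\<alpha> + \<beta> + 1), -1:]"
  have \<Lambda>: "src.eig n = poly \<Lambda> (of_nat n)" for n
    unfolding eigenvalue_jacobi by (simp add: \<Lambda>_def algebra_simps)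
  have deg\<Lambda>: "degree \<Lambda> = 2" by (simp add: \<Lambda>_def)
  obtain e1 where e1: "\<And>n. poly e1 (src.eig n) * pochhammer (of_real (\<alpha> + 1)) n
      = c n * pochhammer (of_real (\<alpha>' + 1)) n"
    using multiplier_at_singular_point[OF jacobi_singular_point_right jacobi_singular_point_right L(1) c] adm
    by blast
  obtain e2 where e2: "\<And>n. poly e2 (src.eig n) * pochhammer (of_real (\<beta> + 1)) n
      = c n * pochhammer (of_real (\<beta>' + 1)) n"
    using multiplier_at_singular_point[OF jacobi_singular_point_left jacobi_singular_point_left L(1) c] adm
    by blast
  have pos: "pochhammer (\<beta> + 1) n > 0" "pochhammer (\<beta>' + 1) n > 0" "pochhammer (\<alpha>' + 1) n > 0" for n
    using adm by (auto intro!: pochhammer_pos)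
  have E: "poly (pcompose e1 \<Lambda>) (of_nat n) * of_real (pochhammer (\<alpha> + 1) n * pochhammer (\<beta>' + 1) n)
      = poly (pcompose e2 \<Lambda>) (of_nat n) * of_real (pochhammer (\<beta> + 1) n * pochhammer (\<alpha>' + 1) n)" for n
    using e1[of n] e2[of n] unfolding pochhammer_of_real poly_pcompose \<Lambda>[symmetric] of_real_mult by algebra
  have "e1 = 0"
  proof (rule ccontr)
    assume "e1 \<noteq> 0"
    then have "pcompose e1 \<Lambda> \<noteq> 0" using deg\<Lambda> by (simp add: pcompose_eq_0_iff)
    from pochhammer_ratio_rational[OF _ _ _ _ E this] adm
    have "2 * (\<alpha> - \<alpha>') = real (2 * degree e2) - real (2 * degree e1)"
      using same by (simp add: degree_pcompose deg\<Lambda>)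
    then have "\<alpha> - \<alpha>' = real (degree e2) - real (degree e1)" by simp
    then have "\<alpha> - \<alpha>' \<in> \<int>" by simp
    with ne show False by contradiction
  qed
  have "L (mops ?w n) = 0" for n
    using e1[of n] \<open>e1 = 0\<close> c[of n] pos(3)[of n] by (simp add: pochhammer_of_real del: of_real_add)
  then show ?thesis by (rule intertwiner_zeroI[OF L(1)])
qed

lemma no_intertwiner_jacobi_different_spectra:
  assumes adm: "\<alpha> > -1" "\<beta> > -1" "\<alpha>' > -1" "\<beta>' > -1" and ne: "\<alpha> + \<beta> \<noteq> \<alpha>' + \<beta>'"
    and L: "L \<in> scalar_ops" "intertwines L (mops (Jacobi \<alpha> \<beta>)) (mops (Jacobi \<alpha>' \<beta>'))"
  shows "L = (\<lambda>_. 0)"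
proof -
  let ?w = "Jacobi \<alpha> \<beta>" and ?w' = "Jacobi \<alpha>' \<beta>'"
  interpret hypergeometric_pair "pearson_a ?w" "pearson_b ?w" "mops ?w" "pearson_a ?w'" "pearson_b ?w'" "mops ?w'"
    by (intro hypergeometric_pair.intro classical_system) (use adm in auto)
  show ?thesis
  proof (rule no_intertwiner_different_spectra[OF jacobi_singular_point_right jacobi_singular_point_right _ _ _ L])
    show "coeff (pearson_a ?w) 2 \<noteq> 0" by (simp add: numeral_2_eq_2)
    have "complex_of_real (\<alpha> + \<beta> - \<alpha>' - \<beta>') \<noteq> of_real 0" unfolding of_real_eq_iff using ne by simp
    then show "complex_of_real (\<alpha> + \<beta> - \<alpha>' - \<beta>') \<noteq> 0" by simp
    show "tgt.eig n = src.eig n + complex_of_real (\<alpha> + \<beta> - \<alpha>' - \<beta>') * of_nat n" for n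
      unfolding eigenvalue_jacobi by (simp add: algebra_simps)
  qed (use adm in auto)
qed

text \<open>
  Translating by \<open>c - c'\<close> carries the operator of \<open>c\<close> into that of \<open>c'\<close>, so the translated polynomial is
  an eigenfunction for \<open>c'\<close>.
\<close>

lemma hermite_translate:
  "mops (Hermite c') n = pcompose (mops (Hermite c) n) [:of_real (c - c'), 1:]"
proof -
  interpret s: hypergeometric_system "pearson_a (Hermite c)" "pearson_b (Hermite c)" "mops (Hermite c)"
    by (rule classical_system) simp
  interpret t: hypergeometric_system "pearson_a (Hermite c')" "pearson_b (Hermite c')" "mops (Hermite c')"
    by (rule classical_system) simp
  define r where "r = pcompose (mops (Hermite c) n) [:of_real (c - c'), 1:]"
  have d: "pderiv (pcompose p [:h, 1:]) = pcompose (pderiv p) [:h, 1:]" for p :: "complex poly" and h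
    by (simp add: pderiv_pcompose pderiv_pCons)
  have "pearson_b (Hermite c') = pcompose (pearson_b (Hermite c)) [:of_real (c - c'), 1:]"
    by (simp add: pcompose_pCons algebra_simps)
  then have "t.\<delta> r = pcompose (s.\<delta> (mops (Hermite c) n)) [:of_real (c - c'), 1:]"
    by (simp add: r_def hyper_op_def d pcompose_add pcompose_mult del: pearson_b.simps)
  also have "\<dots> = smult (t.eig n) r"
    by (simp add: s.eigen eigenvalue_hermite r_def pcompose_smult pcompose_uminus del: pearson_a.simps pearson_b.simps)
  finally have "r = smult (coeff r n) (mops (Hermite c') n)" by (rule t.eigenspace)
  moreover have "coeff r n = 1"
  proof -
    have "degree r = n" by (simp add: r_def degree_pcompose)
    moreover have "lead_coeff r = 1" by (simp add: r_def lead_coeff_comp s.lead_p del: s.degree_p)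
    ultimately show ?thesis by simp
  qed
  ultimately show ?thesis by (simp add: r_def)
qed

text \<open>
  With \<open>c\<^sub>n = C(n)\<close> and \<open>n = -\<lambda>\<^sub>n/2\<close>, the operator \<open>Q = C(-\<delta>/2)\<close> followed by the translation agrees with
  \<open>L\<close> on all \<open>p\<^sub>n\<close>.
\<close>

lemma no_intertwiner_hermite:
  assumes ne: "c \<noteq> c'"
    and L: "L \<in> scalar_ops" "intertwines L (mops (Hermite c)) (mops (Hermite c'))"
  shows "L = (\<lambda>_. 0)"
proof -
  let ?w = "Hermite c" and ?w' = "Hermite c'"
  interpret hypergeometric_pair "pearson_a ?w" "pearson_b ?w" "mops ?w" "pearson_a ?w'" "pearson_b ?w'" "mops ?w'"
    by (intro hypergeometric_pair.intro classical_system) simp_all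
  obtain C where C: "\<And>n. L (mops ?w n) = smult (poly C (of_nat n)) (mops ?w' n)"
    using leading_coefficient_polynomial[OF L] by blast
  define h where "h = complex_of_real (c - c')"
  define Q where "Q = op_poly (pcompose C [:0, -1/2:]) src.\<delta>"
  have Q: "Q \<in> scalar_ops" unfolding Q_def by (intro scalar_ops_op_poly scalar_ops_hyper_op)
  have Qn: "Q (mops ?w n) = smult (poly C (of_nat n)) (mops ?w n)" for n
    unfolding Q_def op_poly_eigen[OF hyper_op_linear src.eigen] eigenvalue_hermite
    by (simp add: poly_pcompose)
  have "L = (\<lambda>p. pcompose (Q p) [:h, 1:])"
  proof (rule src.eq_on_p[OF scalar_ops_linear[OF L(1)]])
    show "poly_linear (\<lambda>p. pcompose (Q p) [:h, 1:])"
      by (rule poly_linearI)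
         (simp_all add: poly_linear_add[OF scalar_ops_linear[OF Q]] poly_linear_smult[OF scalar_ops_linear[OF Q]]
           pcompose_add pcompose_smult)
    show "L (mops ?w n) = pcompose (Q (mops ?w n)) [:h, 1:]" for n
      by (simp add: C Qn pcompose_smult hermite_translate[of c' n c] h_def)
  qed
  moreover have "h \<noteq> 0"
  proof -
    have "complex_of_real (c - c') \<noteq> of_real 0" unfolding of_real_eq_iff using ne by simp
    then show ?thesis by (simp add: h_def)
  qed
  ultimately have "Q = (\<lambda>_. 0)" using translation_not_differential[OF Q L(1)] by metis
  then show ?thesis using \<open>L = _\<close> by simp
qed

lemma no_intertwiner_inequivalent:
  assumes "admissible w" "admissible w'" "same_type w w'" "\<not> equivalent w w'"
    and "L \<in> scalar_ops" "intertwines L (mops w) (mops w')"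
  shows "L = (\<lambda>_. 0)"
proof (cases w)
  case (Hermite c)
  with assms(3) obtain c' where w': "w' = Hermite c'" by (cases w') auto
  show ?thesis using assms no_intertwiner_hermite[of c c' L] unfolding Hermite w' by simp
next
  case (Laguerre \<alpha>)
  with assms(3) obtain \<alpha>' where w': "w' = Laguerre \<alpha>'" by (cases w') auto
  show ?thesis using assms no_intertwiner_laguerre[of \<alpha> \<alpha>' L] unfolding Laguerre w'
    by (simp del: weight.simps)
next
  case (Jacobi \<alpha> \<beta>)
  with assms(3) obtain \<alpha>' \<beta>' where w': "w' = Jacobi \<alpha>' \<beta>'" by (cases w') auto
  show ?thesis
    using assms no_intertwiner_jacobi_isospectral[of \<alpha> \<beta> \<alpha>' \<beta>' L]
      no_intertwiner_jacobi_different_spectra[of \<alpha> \<beta> \<alpha>' \<beta>' L]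
    unfolding Jacobi w' by (cases "\<alpha> + \<beta> = \<alpha>' + \<beta>'") (simp_all del: weight.simps)
qed

subsection \<open>Darboux transformations\<close>

lemma closure_support_equal:
  assumes "same_type w w'"
  shows "{x. weight w x \<noteq> 0} = {x. weight w' x \<noteq> 0}"
  using assms by (cases w; cases w') auto

text \<open>
  A degree-preserving operator does not annihilate \<open>1\<close>, so the first factor of a Darboux transformation
  is a nonzero intertwining operator. Conversely, the explicit operators in the two directions
  compose to an element of \<open>\<D>(w')\<close>.
\<close>

lemma darboux_iff_equivalent:
  assumes adm: "admissible w" "admissible w'" and st: "same_type w w'" and ne: "w \<noteq> w'"
  shows "darboux_transformation (weight w') (weight w) \<longleftrightarrow> equivalent w w'"
proof
  assume "darboux_transformation (weight w') (weight w)"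
  then obtain V where V: "V \<in> scalar_ops" "degree_preserving V" "intertwines V (mops w') (mops w)"
    unfolding darboux_transformation_def intertwines_def by blast
  have "V 1 \<noteq> 0" using V(2) by (simp add: degree_preserving_def)
  then have "V \<noteq> (\<lambda>_. 0)" by auto
  moreover have "same_type w' w" using st by (cases w; cases w') auto
  ultimately have "equivalent w' w" using no_intertwiner_inequivalent[OF adm(2,1)] V by blast
  then show "equivalent w w'" by (rule equivalent_sym)
next
  assume eq: "equivalent w w'"
  note V = explicit_T_properties[OF adm(2,1) equivalent_sym[OF eq] ne[symmetric]]
  note N = explicit_T_properties[OF adm eq ne]
  have "intertwines (explicit_T w' w \<odot> explicit_T w w') (mops w') (mops w')"
    unfolding intertwines_def
  proof
    fix n
    obtain s t where "explicit_T w' w (mops w' n) = smult s (mops w n)"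
      "explicit_T w w' (mops w n) = smult t (mops w' n)"
      using V(3) N(3) unfolding intertwines_def by metis
    then show "\<exists>c. (explicit_T w' w \<odot> explicit_T w w') (mops w' n) = smult c (mops w' n)"
      by (simp add: op_mult_def poly_linear_smult[OF scalar_ops_linear[OF N(1)]]) metis
  qed
  then have "explicit_T w' w \<odot> explicit_T w w' \<in> scalar_D (weight w')"
    by (simp add: scalar_D_eq scalar_ops_compose V(1) N(1))
  then show "darboux_transformation (weight w') (weight w)"
    unfolding darboux_transformation_def closure_support_equal[OF st]
    using V(1-3) N(1-3) by (auto simp: intertwines_def)
qed

lemma intertwines_zero: "intertwines (\<lambda>_. 0) p q"
  unfolding intertwines_def by (metis smult_0_left)

text \<open>
  The scalar form of the result. For inequivalent weights both sides are \<open>{0}\<close>, since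
  \<open>\<D>(w')\<close> is nonempty.
\<close>

theorem scalar_intertwiners:
  assumes adm: "admissible w" "admissible w'" and st: "same_type w w'"
  shows "{L \<in> scalar_ops. intertwines L (mops w) (mops w')} = (\<lambda>d. T_op w w' \<odot> d) ` scalar_D (weight w')"
proof -
  have zero: "(\<lambda>_. 0) \<in> scalar_D (weight w')"
    by (simp add: scalar_D_eq scalar_ops_zero intertwines_zero)
  consider "w = w'" | "w \<noteq> w'" "equivalent w w'" | "\<not> equivalent w w'" "w \<noteq> w'"
    by blast
  then show ?thesis
  proof cases
    case 1
    then show ?thesis by (simp add: T_op_def scalar_D_eq op_mult_def)
  next
    case 2
    then have T: "T_op w w' = explicit_T w w'" using darboux_iff_equivalent[OF adm st] by (simp add: T_op_def)
    note N = explicit_T_properties[OF adm 2(2,1)]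
    have "intertwines (explicit_T w w' \<odot> d) (mops w) (mops w')"
      if d: "d \<in> scalar_ops" "intertwines d (mops w') (mops w')" for d
      unfolding intertwines_def
    proof
      fix n
      obtain s t where "explicit_T w w' (mops w n) = smult s (mops w' n)" "d (mops w' n) = smult t (mops w' n)"
        using N(3) d(2) unfolding intertwines_def by metis
      then show "\<exists>c. (explicit_T w w' \<odot> d) (mops w n) = smult c (mops w' n)"
        by (simp add: op_mult_def poly_linear_smult[OF scalar_ops_linear[OF d(1)]]) metis
    qed
    then show ?thesis
      unfolding T scalar_D_eq using N(1,4) scalar_ops_compose by (auto simp: image_iff)
  next
    case 3
    then have T: "T_op w w' = (\<lambda>_. 0)" using darboux_iff_equivalent[OF adm st] by (simp add: T_op_def)
    have "T_op w w' \<odot> d = (\<lambda>_. 0)" if "d \<in> scalar_D (weight w')" for d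
    proof -
      have "d 0 = 0" using that by (intro poly_linear_0 scalar_ops_linear) (simp add: scalar_D_eq)
      then show ?thesis by (simp add: T op_mult_def)
    qed
    moreover have "{L \<in> scalar_ops. intertwines L (mops w) (mops w')} = {\<lambda>_. 0}"
      using no_intertwiner_inequivalent[OF adm st 3(1)] scalar_ops_zero intertwines_zero by blast
    ultimately show ?thesis using zero by (auto simp: image_iff)
  qed
qed

section \<open>Diagonal matrix weights\<close>

lemma mat_pderiv_nth: "(mat_pderiv ^^ k) P $ r $ s = (pderiv ^^ k) (P $ r $ s)"
  by (induction k) (simp_all add: mat_pderiv_def)

text \<open>
  The action of a matrix of scalar operators on a row of polynomials; the index order is that of a row vector
  times a matrix, because operators act on the right.
\<close>

definition mat_of_ops :: "('n::finite \<Rightarrow> 'n \<Rightarrow> scalar_op) \<Rightarrow> 'n mat_op" where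
  "mat_of_ops L = (\<lambda>P. \<chi> r s. \<Sum>i\<in>UNIV. L i s (P $ r $ i))"

text \<open>
  In the nontrivial direction the finitely many entries are padded to a common order \<open>M\<close>.
\<close>

lemma mat_ops_eq: "(mat_ops :: 'n::finite mat_op set) = mat_of_ops ` {L. \<forall>i j. L i j \<in> scalar_ops}"
proof (intro equalityI subsetI)
  fix D :: "'n mat_op" assume "D \<in> mat_ops"
  then obtain m F where D: "D = (\<lambda>P. \<Sum>k\<le>m. (mat_pderiv ^^ k) P ** F k)"
    by (auto simp: mat_ops_def)
  define L where "L i j = (\<lambda>p. \<Sum>k\<le>m. (pderiv ^^ k) p * (F k $ i $ j))" for i j
  have "D = mat_of_ops L"
    by (auto simp: D mat_of_ops_def L_def fun_eq_iff vec_eq_iff matrix_matrix_mult_def mat_pderiv_nth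
        intro: sum.swap)
  moreover have "L i j \<in> scalar_ops" for i j
    by (rule scalar_opsI[where m = m and F = "\<lambda>k. F k $ i $ j"]) (simp add: L_def)
  ultimately show "D \<in> mat_of_ops ` {L. \<forall>i j. L i j \<in> scalar_ops}" by blast
next
  fix D :: "'n mat_op" assume "D \<in> mat_of_ops ` {L. \<forall>i j. L i j \<in> scalar_ops}"
  then obtain L where D: "D = mat_of_ops L" and L: "\<And>i j. L i j \<in> scalar_ops" by blast
  define R where "R i j m F \<longleftrightarrow> L i j = (\<lambda>p. \<Sum>k\<le>m. (pderiv ^^ k) p * F k) \<and> (\<forall>k>m. F k = 0)" for i j m F
  have "\<exists>m F. R i j m F" for i j
    unfolding R_def using L[of i j] by (rule scalar_opsE) blast
  then obtain m F where "\<And>i j. R i j (m i j) (F i j)" by metis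
  then have F: "\<And>i j. L i j = (\<lambda>p. \<Sum>k\<le>m i j. (pderiv ^^ k) p * F i j k)"
    and F0: "\<And>i j k. k > m i j \<Longrightarrow> F i j k = 0" unfolding R_def by blast+
  define M where "M = Max (range (\<lambda>(i, j). m i j))"
  have M: "m i j \<le> M" for i j
    unfolding M_def by (rule Max_ge) (auto intro: rev_image_eqI[of "(i, j)"])
  have L': "L i j p = (\<Sum>k\<le>M. (pderiv ^^ k) p * F i j k)" for i j p
    unfolding F by (rule scalar_ops_pad) (use F0 M in auto)
  have "D = (\<lambda>P. \<Sum>k\<le>M. (mat_pderiv ^^ k) P ** (\<chi> i j. F i j k))"
    by (auto simp: D mat_of_ops_def L' fun_eq_iff vec_eq_iff matrix_matrix_mult_def mat_pderiv_nth
        intro: sum.swap)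
  then show "D \<in> mat_ops" unfolding mat_ops_def by (intro CollectI exI)
qed

lemma sum_op_unit:
  fixes L :: "'n::finite \<Rightarrow> 'n \<Rightarrow> scalar_op"
  shows "(\<lambda>P. \<Sum>i\<in>UNIV. \<Sum>j\<in>UNIV. op_unit (L i j) i j P) = mat_of_ops L"
proof (rule ext, unfold vec_eq_iff, intro allI)
  fix P :: "'n matpoly" and r s
  have "op_unit (L i j) i j P $ r $ s = (if j = s then L i j (P $ r $ i) else 0)" for i j
    by (simp add: op_unit_def matrix_matrix_mult_def matrix_unit_def if_distrib[of "times _"] cong: if_cong)
  then show "(\<Sum>i\<in>UNIV. \<Sum>j\<in>UNIV. op_unit (L i j) i j P) $ r $ s = mat_of_ops L P $ r $ s"
    by (simp add: mat_of_ops_def)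
qed

definition diag_weight :: "('n \<Rightarrow> real \<Rightarrow> real) \<Rightarrow> real \<Rightarrow> complex ^'n ^'n::finite" where
  "diag_weight v x = (\<chi> i j. if i = j then complex_of_real (v i x) else 0)"

definition diag_poly :: "('n \<Rightarrow> complex poly) \<Rightarrow> 'n::finite matpoly" where
  "diag_poly p = (\<chi> i j. if i = j then p i else 0)"

context
  fixes v :: "'n::finite \<Rightarrow> real \<Rightarrow> real"
  assumes v: "\<And>i. moment_weight (v i)"
begin

text \<open>
  The Bochner integral of a matrix-valued function is computed entrywise by writing the integrand as a
  sum of integrable scalar functions, each embedded by a bounded linear map \<open>T r s\<close>.
\<close>

lemma mat_inner_diag:
  "mat_inner (diag_weight v) P Q $ r $ s = (\<Sum>i\<in>UNIV. scalar_inner (v i) (P $ r $ i) (Q $ s $ i))"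
proof -
  define f where "f r s x = (\<Sum>i\<in>UNIV. poly (P $ r $ i) (complex_of_real x) * complex_of_real (v i x)
      * cnj (poly (Q $ s $ i) (complex_of_real x)))" for r s x
  define T where "T r s z = (\<chi> i j. if i = r \<and> j = s then z else 0 :: complex ^'n ^'n)" for r s and z :: complex
  have f: "integrable lborel (f r s)" for r s
    unfolding f_def by (intro Bochner_Integration.integrable_sum moment_weight.inner_integrable v)
  have T: "bounded_linear (T r s)" for r s
    unfolding linear_conv_bounded_linear[symmetric]
    by (rule linearI) (auto simp: T_def vec_eq_iff)
  have "mat_eval P x ** diag_weight v x ** mat_adjoint (mat_eval Q x) = (\<Sum>r\<in>UNIV. \<Sum>s\<in>UNIV. T r s (f r s x))" for x
  proof -
    have "(mat_eval P x ** diag_weight v x ** mat_adjoint (mat_eval Q x)) $ r $ s = f r s x" for r s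
      by (simp add: matrix_matrix_mult_def mat_eval_def diag_weight_def mat_adjoint_def f_def
          if_distrib[of "times _"] cong: if_cong)
    moreover have "(\<Sum>r\<in>UNIV. \<Sum>s\<in>UNIV. T r s (f r s x)) $ i $ j = f i j x" for i j
    proof -
      have "(\<Sum>s\<in>UNIV. if i = r \<and> j = s then f r s x else 0) = (if i = r then f i j x else 0)" for r
        by (cases "i = r") simp_all
      then show ?thesis by (simp add: T_def)
    qed
    ultimately show ?thesis by (simp add: vec_eq_iff)
  qed
  then have "mat_inner (diag_weight v) P Q = (\<integral>x. (\<Sum>r\<in>UNIV. \<Sum>s\<in>UNIV. T r s (f r s x)) \<partial>lborel)"
    by (simp add: mat_inner_def)
  also have "\<dots> = (\<Sum>r\<in>UNIV. \<Sum>s\<in>UNIV. T r s (\<integral>x. f r s x \<partial>lborel))"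
    using integrable_bounded_linear[OF T f] integral_bounded_linear[OF T f]
    by (simp add: Bochner_Integration.integral_sum Bochner_Integration.integrable_sum)
  finally have "mat_inner (diag_weight v) P Q $ r $ s
      = (\<Sum>i\<in>UNIV. \<Sum>j\<in>UNIV. if r = i \<and> s = j then \<integral>x. f i j x \<partial>lborel else 0)"
    by (simp add: T_def)
  also have "\<dots> = (\<Sum>i\<in>UNIV. if r = i then \<integral>x. f r s x \<partial>lborel else 0)"
    by (rule sum.cong) (auto simp: if_distrib cong: if_cong)
  also have "\<dots> = (\<integral>x. f r s x \<partial>lborel)" by simp
  also have "\<dots> = (\<Sum>i\<in>UNIV. scalar_inner (v i) (P $ r $ i) (Q $ s $ i))"
    unfolding f_def scalar_inner_def
    by (intro Bochner_Integration.integral_sum moment_weight.inner_integrable v)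
  finally show ?thesis .
qed

lemma mat_inner_diag_poly:
  "mat_inner (diag_weight v) P (diag_poly q) $ r $ s = scalar_inner (v s) (P $ r $ s) (q s)"
proof -
  have "scalar_inner (v i) (P $ r $ i) (diag_poly q $ s $ i)
      = (if i = s then scalar_inner (v s) (P $ r $ s) (q s) else 0)" for i
    using moment_weight.inner_0_right[OF v] by (auto simp: diag_poly_def)
  then show ?thesis unfolding mat_inner_diag by simp
qed

lemma diag_mops: "is_mat_mops (diag_weight v) (\<lambda>n. diag_poly (\<lambda>i. scalar_mops (v i) n))"
proof -
  note m = moment_weight.degree_mops[OF v] moment_weight.lead_mops[OF v]
  have "mat_coeff (diag_poly (\<lambda>i. scalar_mops (v i) n)) n = mat 1" for n
    using m(2)[of _ n] unfolding m(1) by (auto simp: mat_coeff_def diag_poly_def mat_def vec_eq_iff)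
  moreover have "mat_coeff (diag_poly (\<lambda>i. scalar_mops (v i) n)) k = 0" if "k > n" for n k
    using that m(1) by (auto simp: mat_coeff_def diag_poly_def vec_eq_iff coeff_eq_0)
  moreover have "mat_inner (diag_weight v) (diag_poly (\<lambda>i. scalar_mops (v i) n)) (diag_poly (\<lambda>i. scalar_mops (v i) m)) = 0"
    if "n \<noteq> m" for n m
    unfolding vec_eq_iff mat_inner_diag_poly
    using that is_scalar_mopsD(3)[OF moment_weight.scalar_mops[OF v]] moment_weight.inner_0_left[OF v]
    by (auto simp: diag_poly_def)
  ultimately show ?thesis unfolding is_mat_mops_def by blast
qed

text \<open>
  By induction the lower \<open>P\<^sub>m\<close> are already diagonal, so the entry \<open>(r, s)\<close> of \<open>P\<^sub>n\<close> is orthogonal to the scalar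
  orthogonal polynomials of the \<open>s\<close>-th weight of degree below \<open>n\<close>.
\<close>

lemma mat_mops_unique:
  assumes P: "is_mat_mops (diag_weight v) P"
  shows "P n = diag_poly (\<lambda>i. scalar_mops (v i) n)"
proof (induction n rule: less_induct)
  case (less n)
  have coeff: "coeff (P n $ r $ s) k = (if k = n then (if r = s then 1 else 0) else 0)" if "k \<ge> n" for r s k
  proof -
    have "mat_coeff (P n) k = (if k = n then mat 1 else 0)"
      using P that unfolding is_mat_mops_def by auto
    then have "mat_coeff (P n) k $ r $ s = (if k = n then mat 1 else 0) $ r $ s" by simp
    then show ?thesis by (simp add: mat_coeff_def mat_def split: if_splits)
  qed
  have "P n $ r $ s - diag_poly (\<lambda>i. scalar_mops (v i) n) $ r $ s = 0" for r s
  proof -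
    interpret moment_weight "v s" by (rule v)
    show ?thesis
    proof (rule orthogonal_to_mops_zero[OF scalar_mops])
      fix k assume k: "n \<le> k"
      have "coeff (diag_poly (\<lambda>i. scalar_mops (v i) n) $ r $ s) k = (if k = n then (if r = s then 1 else 0) else 0)"
        using k lead_mops[of n] unfolding degree_mops by (auto simp: diag_poly_def coeff_eq_0 degree_mops)
      then show "coeff (P n $ r $ s - diag_poly (\<lambda>i. scalar_mops (v i) n) $ r $ s) k = 0"
        using coeff[OF k] by simp
    next
      fix m assume m: "m < n"
      then have "mat_inner (diag_weight v) (P n) (P m) $ r $ s = 0"
        using P by (auto simp: is_mat_mops_def)
      then have "ip (P n $ r $ s) (scalar_mops (v s) m) = 0"
        unfolding less.IH[OF m] mat_inner_diag_poly .
      moreover have "ip (diag_poly (\<lambda>i. scalar_mops (v i) n) $ r $ s) (scalar_mops (v s) m) = 0"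
        using is_scalar_mopsD(3)[OF scalar_mops, of n m] m by (auto simp: diag_poly_def)
      ultimately show "ip (P n $ r $ s - diag_poly (\<lambda>i. scalar_mops (v i) n) $ r $ s) (scalar_mops (v s) m) = 0"
        by (simp add: inner_diff_left)
    qed
  qed
  then show ?case by (simp add: vec_eq_iff)
qed

lemma mat_mops_diag: "mat_mops (diag_weight v) n = diag_poly (\<lambda>i. scalar_mops (v i) n)"
proof -
  have "mat_mops (diag_weight v) = (\<lambda>n. diag_poly (\<lambda>i. scalar_mops (v i) n))"
    unfolding mat_mops_def by (rule the_equality, rule diag_mops, rule ext, erule mat_mops_unique)
  then show ?thesis by simp
qed

text \<open>
  On the diagonal matrix \<open>P\<^sub>n\<close> both sides of \<open>P\<^sub>n \<cdot> D = \<Lambda> P\<^sub>n\<close> have a single term in each entry, and the entries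
  of \<open>\<Lambda>\<close> can be chosen independently.
\<close>

lemma mat_D_diag:
  "mat_D (diag_weight v) = mat_of_ops ` {L. \<forall>i j. L i j \<in> scalar_ops \<and>
      intertwines (L i j) (scalar_mops (v i)) (scalar_mops (v j))}"
proof -
  have "(\<forall>n. \<exists>\<Lambda>. mat_of_ops L (mat_mops (diag_weight v) n) = mat_const \<Lambda> ** mat_mops (diag_weight v) n)
     \<longleftrightarrow> (\<forall>i j. intertwines (L i j) (scalar_mops (v i)) (scalar_mops (v j)))"
    if L: "\<And>i j. L i j \<in> scalar_ops" for L
  proof -
    have l: "mat_of_ops L (diag_poly p) $ r $ s = L r s (p r)" for p r s
    proof -
      have "L i s (if r = i then p r else 0) = (if r = i then L r s (p r) else 0)" for i
        using poly_linear_0[OF scalar_ops_linear[OF L]] by simp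
      then show ?thesis by (simp add: mat_of_ops_def diag_poly_def cong: if_cong)
    qed
    have r: "(mat_const \<Lambda> ** diag_poly p) $ r $ s = smult (\<Lambda> $ r $ s) (p s)" for \<Lambda> :: "complex ^'n ^'n" and p r s
      by (simp add: matrix_matrix_mult_def mat_const_def diag_poly_def if_distrib[of "times _"] cong: if_cong)
    have "(\<exists>\<Lambda>. mat_of_ops L (diag_poly p) = mat_const \<Lambda> ** diag_poly q') \<longleftrightarrow> (\<forall>i j. \<exists>c. L i j (p i) = smult c (q' j))" for p q'
    proof
      assume "\<forall>i j. \<exists>c. L i j (p i) = smult c (q' j)"
      then obtain c where "\<And>i j. L i j (p i) = smult (c i j) (q' j)" by metis
      then have "mat_of_ops L (diag_poly p) = mat_const (\<chi> i j. c i j) ** diag_poly q'"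
        by (simp add: vec_eq_iff l r)
      then show "\<exists>\<Lambda>. mat_of_ops L (diag_poly p) = mat_const \<Lambda> ** diag_poly q'" by blast
    qed (auto simp: vec_eq_iff l r)
    then show ?thesis unfolding mat_mops_diag intertwines_def by (simp only:) blast
  qed
  then have "D \<in> mat_D (diag_weight v) \<longleftrightarrow> (\<exists>L. D = mat_of_ops L \<and> (\<forall>i j. L i j \<in> scalar_ops) \<and>
      (\<forall>i j. intertwines (L i j) (scalar_mops (v i)) (scalar_mops (v j))))" for D
    unfolding mat_D_def mat_ops_eq by blast
  then show ?thesis by (intro set_eqI) (simp only:, blast)
qed

end

theorem theorem6p1:
  fixes w :: "'n::finite \<Rightarrow> classical_weight"
  assumes "\<And>i. admissible (w i)"
    and "\<And>i j. same_type (w i) (w j)"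
  shows "mat_D (direct_sum w) =
    {(\<lambda>P. \<Sum>i\<in>UNIV. \<Sum>j\<in>UNIV. op_unit (T_op (w i) (w j) \<odot> d i j) i j P) | d.
       \<forall>i j. d i j \<in> scalar_D (weight (w j))}"
proof -
  have mw: "moment_weight (weight (w i))" for i
    using classical_pearson[OF assms(1)] by (rule pearson_weight.axioms)
  have "direct_sum w = diag_weight (\<lambda>i. weight (w i))"
    by (simp add: fun_eq_iff direct_sum_def diag_weight_def)
  then have "mat_D (direct_sum w) = mat_of_ops ` {L. \<forall>i j. L i j \<in> scalar_ops \<and>
      intertwines (L i j) (mops (w i)) (mops (w j))}"
    using mat_D_diag[OF mw] by simp
  also have "{L. \<forall>i j. L i j \<in> scalar_ops \<and> intertwines (L i j) (mops (w i)) (mops (w j))}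
      = {L. \<forall>i j. \<exists>d \<in> scalar_D (weight (w j)). L i j = T_op (w i) (w j) \<odot> d}"
    using scalar_intertwiners[OF assms(1,1,2)] by (simp add: set_eq_iff image_iff)
  finally have D: "mat_D (direct_sum w)
      = mat_of_ops ` {L. \<forall>i j. \<exists>d \<in> scalar_D (weight (w j)). L i j = T_op (w i) (w j) \<odot> d}" .
  show ?thesis unfolding sum_op_unit D
  proof (intro equalityI subsetI)
    fix X assume "X \<in> mat_of_ops ` {L. \<forall>i j. \<exists>d \<in> scalar_D (weight (w j)). L i j = T_op (w i) (w j) \<odot> d}"
    then obtain L where X: "X = mat_of_ops L"
      and L: "\<forall>i j. \<exists>d. d \<in> scalar_D (weight (w j)) \<and> L i j = T_op (w i) (w j) \<odot> d" by blast
    from L obtain d where d: "\<forall>i j. d i j \<in> scalar_D (weight (w j)) \<and> L i j = T_op (w i) (w j) \<odot> d i j"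
      by metis
    then have "L = (\<lambda>i j. T_op (w i) (w j) \<odot> d i j)" by (simp add: fun_eq_iff)
    with X d show "X \<in> {mat_of_ops (\<lambda>i j. T_op (w i) (w j) \<odot> d i j) | d. \<forall>i j. d i j \<in> scalar_D (weight (w j))}"
      by blast
  qed blast
qed

end
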